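(* Let $\mathcal{D}=(V,E)$ be a directed acyclic graph. Then for all pairwise disjoint $I,J,K\subseteq V$: if there is no $*$-connecting path relative to $K$ between a node of $I$ and a node of $J$ in the conditional reachability DAG $\mathcal{D}^*_K$, then for every coefficient matrix $C$ with support included in $\mathcal{D}$, the max-linear Bayesian network $X$ with coefficient matrix $C$ satisfies that $X_I$ and $X_J$ are conditionally independent given $X_K$.
   Context: Max-linear Bayesian network: $V=\{1,\dots,d\}$; a coefficient matrix $C=(c_{ij})\in[0,\infty)^{d\times d}$ has support included in the directed acyclic graph (DAG) $\mathcal{D}=(V,E)$ if $c_{ij}>0$ implies $j\to i\in E$. The innovations $Z_1,\dots,Z_d$ are independent with atom-free distributions having support $(0,\infty)$. $X=(X_1,\dots,X_d)$ is defined by $X_i=\max\{Z_i,\max_{j\to i\in E}c_{ij}X_j\}$. A directed path from $j$ to $i$ factors through $K$ if it contains a node $k\in K$ with $k\ne i,j$. The conditional reachability DAG $\mathcal{D}^*_K$ is the graph on $V$ with an edge $j\to i$ ($i\neq j$) if and only if there exists a directed path from $j$ to $i$ in $\mathcal{D}$ that does not factor through $K$. $*$-connecting paths: an undirected path between $i$ and $j$ in a DAG on $V$ is $*$-connecting relative to $K$ if, up to exchanging $i$ and $j$, it has one of the following forms, where the nodes are distinct, $k\in K$, and all the other nodes shown are not in $K$: (a) $j\to i$; (b) $j\leftarrow j'\to i$; (c) $j\to k\leftarrow i$; (d) $j\leftarrow j'\to k\leftarrow i$; (e) $j\leftarrow j'\to k\leftarrow i'\to i$. *)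

theory Defs
  imports "HOL-Probability.Probability" "Graph_Theory.Pair_Digraph"
begin

section \<open>Graphs\<close>

text \<open>An arc \<open>(j, i)\<close> of a digraph stands for the edge \<open>j \<rightarrow> i\<close>.\<close>

definition is_dag :: "'v pair_pre_digraph \<Rightarrow> bool" where
  "is_dag D \<longleftrightarrow> pair_digraph D \<and> acyclic (parcs D)"

text \<open>Paths are lists of arcs, as in \<open>Graph_Theory\<close>.\<close>

definition factors_through :: "'v set \<Rightarrow> 'v \<Rightarrow> ('v \<times> 'v) awalk \<Rightarrow> 'v \<Rightarrow> bool" where
  "factors_through K j p i \<longleftrightarrow> (\<exists>k\<in>K. k \<in> set (pawalk_verts j p) \<and> k \<noteq> i \<and> k \<noteq> j)"

definition cond_reach_dag :: "'v pair_pre_digraph \<Rightarrow> 'v set \<Rightarrow> 'v pair_pre_digraph" where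
  "cond_reach_dag D K =
    \<lparr> pverts = pverts D,
      parcs = {(j, i). i \<noteq> j \<and>
        (\<exists>p. pre_digraph.apath (with_proj D) j p i \<and> \<not> factors_through K j p i)} \<rparr>"

text \<open>
  Undirected paths in a DAG are given by their node sequence, which determines the edges used
  since two nodes are joined by at most one edge. The five forms are read from \<open>j\<close> to \<open>i\<close>.
\<close>

inductive star_form :: "'v pair_pre_digraph \<Rightarrow> 'v set \<Rightarrow> 'v list \<Rightarrow> bool"
  for G :: "'v pair_pre_digraph" and K :: "'v set" where
  a: "\<lbrakk>(j, i) \<in> parcs G; distinct [j, i]; {j, i} \<inter> K = {}\<rbrakk>
      \<Longrightarrow> star_form G K [j, i]"
| b: "\<lbrakk>(j', j) \<in> parcs G; (j', i) \<in> parcs G;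
       distinct [j, j', i]; {j, j', i} \<inter> K = {}\<rbrakk>
      \<Longrightarrow> star_form G K [j, j', i]"
| c: "\<lbrakk>(j, k) \<in> parcs G; (i, k) \<in> parcs G;
       distinct [j, k, i]; k \<in> K; {j, i} \<inter> K = {}\<rbrakk>
      \<Longrightarrow> star_form G K [j, k, i]"
| d: "\<lbrakk>(j', j) \<in> parcs G; (j', k) \<in> parcs G; (i, k) \<in> parcs G;
       distinct [j, j', k, i]; k \<in> K; {j, j', i} \<inter> K = {}\<rbrakk>
      \<Longrightarrow> star_form G K [j, j', k, i]"
| e: "\<lbrakk>(j', j) \<in> parcs G; (j', k) \<in> parcs G; (i', k) \<in> parcs G; (i', i) \<in> parcs G;
       distinct [j, j', k, i', i]; k \<in> K; {j, j', i', i} \<inter> K = {}\<rbrakk>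
      \<Longrightarrow> star_form G K [j, j', k, i', i]"

definition star_connecting_path ::
    "'v pair_pre_digraph \<Rightarrow> 'v set \<Rightarrow> 'v \<Rightarrow> 'v list \<Rightarrow> 'v \<Rightarrow> bool" where
  "star_connecting_path G K i p j \<longleftrightarrow>
    p \<noteq> [] \<and> hd p = i \<and> last p = j \<and> (star_form G K p \<or> star_form G K (rev p))"

section \<open>Max-linear Bayesian networks\<close>

text \<open>\<open>C i j\<close> is the coefficient of the edge \<open>j \<rightarrow> i\<close>.\<close>

definition coeff_matrix :: "'v pair_pre_digraph \<Rightarrow> ('v \<Rightarrow> 'v \<Rightarrow> real) \<Rightarrow> bool" where
  "coeff_matrix D C \<longleftrightarrow>
    (\<forall>i\<in>pverts D. \<forall>j\<in>pverts D. C i j \<ge> 0 \<and> (C i j > 0 \<longrightarrow> (j, i) \<in> parcs D))"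

text \<open>
  The measure is concentrated on \<open>S\<close> and its topological support, taken in the subspace \<open>S\<close>,
  is all of \<open>S\<close>. The support is relative to \<open>S\<close> because a support in the whole space is
  closed and could not equal the open half-line used below.
\<close>

definition has_support :: "'a::topological_space measure \<Rightarrow> 'a set \<Rightarrow> bool" where
  "has_support \<mu> S \<longleftrightarrow>
    (AE x in \<mu>. x \<in> S) \<and> {x \<in> S. \<forall>U. open U \<and> x \<in> U \<longrightarrow> emeasure \<mu> (U \<inter> S) > 0} = S"

definition atom_free :: "'a measure \<Rightarrow> bool" where
  "atom_free \<mu> \<longleftrightarrow> (\<forall>x\<in>space \<mu>. emeasure \<mu> {x} = 0)"

definition (in prob_space) innovations :: "'v set \<Rightarrow> ('v \<Rightarrow> 'a \<Rightarrow> real) \<Rightarrow> bool" where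
  "innovations V Z \<longleftrightarrow>
    indep_vars (\<lambda>_. borel) Z V \<and>
    (\<forall>i\<in>V. atom_free (distr M borel (Z i)) \<and> has_support (distr M borel (Z i)) {0<..})"

definition (in prob_space) max_linear_bn ::
    "'v pair_pre_digraph \<Rightarrow> ('v \<Rightarrow> 'v \<Rightarrow> real) \<Rightarrow> ('v \<Rightarrow> 'a \<Rightarrow> real) \<Rightarrow> ('v \<Rightarrow> 'a \<Rightarrow> real) \<Rightarrow> bool" where
  "max_linear_bn D C Z X \<longleftrightarrow>
    (\<forall>\<omega>\<in>space M. \<forall>i\<in>pverts D.
      X i \<omega> = Max (insert (Z i \<omega>) {C i j * X j \<omega> | j. (j, i) \<in> parcs D}))"

section \<open>Conditional independence\<close>

definition (in prob_space) cond_indep_var ::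
    "'b measure \<Rightarrow> ('a \<Rightarrow> 'b) \<Rightarrow> 'c measure \<Rightarrow> ('a \<Rightarrow> 'c) \<Rightarrow> 'd measure \<Rightarrow> ('a \<Rightarrow> 'd) \<Rightarrow> bool" where
  "cond_indep_var N\<^sub>1 X N\<^sub>2 Y N\<^sub>3 W \<longleftrightarrow>
    random_variable N\<^sub>1 X \<and> random_variable N\<^sub>2 Y \<and> random_variable N\<^sub>3 W \<and>
    (\<forall>A\<in>sets N\<^sub>1. \<forall>B\<in>sets N\<^sub>2. AE \<omega> in M.
      real_cond_exp M (vimage_algebra (space M) W N\<^sub>3)
          (indicator {\<omega>\<in>space M. X \<omega> \<in> A \<and> Y \<omega> \<in> B}) \<omega> =
      real_cond_exp M (vimage_algebra (space M) W N\<^sub>3)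
          (indicator {\<omega>\<in>space M. X \<omega> \<in> A}) \<omega> *
      real_cond_exp M (vimage_algebra (space M) W N\<^sub>3)
          (indicator {\<omega>\<in>space M. Y \<omega> \<in> B}) \<omega>)"

definition (in prob_space) cond_indep_subvectors ::
    "('v \<Rightarrow> 'a \<Rightarrow> real) \<Rightarrow> 'v set \<Rightarrow> 'v set \<Rightarrow> 'v set \<Rightarrow> bool" where
  "cond_indep_subvectors X I J K \<longleftrightarrow>
    cond_indep_var
      (PiM I (\<lambda>_. borel)) (\<lambda>\<omega>. \<lambda>i\<in>I. X i \<omega>)
      (PiM J (\<lambda>_. borel)) (\<lambda>\<omega>. \<lambda>j\<in>J. X j \<omega>)
      (PiM K (\<lambda>_. borel)) (\<lambda>\<omega>. \<lambda>k\<in>K. X k \<omega>)"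

end

theory Submission
  imports Defs
begin

text \<open>
  Condition on \<open>X\<^sub>K\<close>. Unrolling the recursion until observed nodes are met writes every \<open>X\<^sub>i\<close> as the
  maximum of weighted observed values and of weighted innovations \<open>Z\<^sub>j\<close>, where \<open>j\<close> either is \<open>i\<close> or
  is joined to \<open>i\<close> in \<open>D\<^sup>*\<^sub>K\<close> (\<open>max_expansion_exists\<close>). So \<open>X\<^sub>I\<close> depends, given \<open>X\<^sub>K\<close>, on a set
  \<open>A\<^sub>I\<close> of innovations, and \<open>X\<^sub>J\<close> on a set \<open>A\<^sub>J\<close>. Absence of the paths (a) and (b) says that \<open>A\<^sub>I\<close>
  and \<open>A\<^sub>J\<close> are disjoint; absence of (c), (d) and (e) says that no observed node receives
  innovations from both.

  This is not yet enough for independence, because an innovation \<open>h\<close> outside \<open>A\<^sub>I \<union> A\<^sub>J\<close> may enter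
  an observed node \<open>k\<close> fed by \<open>A\<^sub>I\<close> as well as an observed node \<open>k'\<close> fed by \<open>A\<^sub>J\<close>. In a linear
  model it would couple the two sides. Here it does not, since the observed values reveal how they
  arose. The innovations have no atoms, so almost surely each observed value that is not inherited
  from another observed value is attained by exactly one innovation, and two such values
  have one of finitely many critical ratios only if the same innovation attains both
  (\<open>common_candidate_realiser\<close>). If \<open>h\<close> attains both \<open>X\<^sub>k\<close> and \<open>X\<^sub>k\<^sub>'\<close>, the sets \<open>A\<^sub>I\<close> and \<open>A\<^sub>J\<close> merely
  obey upper bounds there; otherwise \<open>h\<close> attains at most one of the two.

  Accordingly \<open>X\<^sub>K\<close> determines a pattern, one of finitely many: which observed values
  are inherited, the partition of the other observed nodes into blocks explained by a common
  innovation, and for every block the set of its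
  possible sources. Source sets of different blocks are disjoint. On the event of one pattern,
  \<open>X\<^sub>K\<close> equals a vector \<open>Y\<close> built from the maxima over the source sets (\<open>rebuilt_eq\<close>), and
  the event itself amounts to a condition on \<open>Y\<close> together with one bound, depending on \<open>Y\<close>, for each
  single innovation (\<open>rebuilt_eqI\<close>). The source sets can be distributed over two groups of
  innovations, one containing \<open>A\<^sub>I\<close> and the other \<open>A\<^sub>J\<close>, so that every component of \<open>Y\<close> is a
  function of one group. Given \<open>Y\<close> the two groups are independent (\<open>cond_prob_joint_indep\<close>), and
  Bayes' rule carries this over from \<open>Y\<close> to \<open>X\<^sub>K\<close> on the event of the pattern
  (\<open>cond_prob_product_local\<close>). Finitely many patterns exhaust the probability space.
\<close>

section \<open>Conditioning on statistics of two independent sources\<close>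

definition joint_algebra :: "'a measure \<Rightarrow> 'a measure \<Rightarrow> 'a measure" where
  "joint_algebra F G = sigma (space F) {A \<inter> B | A B. A \<in> sets F \<and> B \<in> sets G}"

lemma joint_generator_subset:
  assumes "space G = space F"
  shows "{A \<inter> B | A B. A \<in> sets F \<and> B \<in> sets G} \<subseteq> Pow (space F)"
  using sets.sets_into_space by fastforce

lemma space_joint_algebra: "space G = space F \<Longrightarrow> space (joint_algebra F G) = space F"
  unfolding joint_algebra_def by (rule space_measure_of) (rule joint_generator_subset)

lemma sets_joint_algebra:
  "space G = space F \<Longrightarrow> sets (joint_algebra F G) =
     sigma_sets (space F) {A \<inter> B | A B. A \<in> sets F \<and> B \<in> sets G}"
  unfolding joint_algebra_def by (rule sets_measure_of) (rule joint_generator_subset)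

lemma joint_algebra_basic:
  assumes "space G = space F" "A \<in> sets F" "B \<in> sets G"
  shows "A \<inter> B \<in> sets (joint_algebra F G)"
  using assms by (auto simp: sets_joint_algebra)

lemma joint_algebra_upper:
  assumes "space G = space F"
  shows "sets F \<subseteq> sets (joint_algebra F G)" "sets G \<subseteq> sets (joint_algebra F G)"
proof safe
  fix A assume "A \<in> sets F"
  then have "A \<inter> space G \<in> sets (joint_algebra F G)"
    using assms \<open>A \<in> sets F\<close> sets.top[of G] by (intro joint_algebra_basic) auto
  then show "A \<in> sets (joint_algebra F G)"
    using \<open>A \<in> sets F\<close> assms by (simp add: sets.Int_space_eq2)
next
  fix A assume "A \<in> sets G"
  then have "space F \<inter> A \<in> sets (joint_algebra F G)"
    using assms \<open>A \<in> sets G\<close> by (intro joint_algebra_basic) auto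
  then show "A \<in> sets (joint_algebra F G)"
    using \<open>A \<in> sets G\<close> assms by (metis sets.Int_space_eq1)
qed

lemma joint_algebra_least:
  assumes "space G = space F" "space H = space F" "sets F \<subseteq> sets H" "sets G \<subseteq> sets H"
  shows "sets (joint_algebra F G) \<subseteq> sets H"
proof -
  have "{A \<inter> B | A B. A \<in> sets F \<and> B \<in> sets G} \<subseteq> sets H"
    using assms by auto
  then show ?thesis
    using assms sets.sigma_sets_subset[of _ H] by (simp add: sets_joint_algebra)
qed

lemma subalgebra_joint:
  assumes "subalgebra M F" "subalgebra M G"
  shows "subalgebra M (joint_algebra F G)"
proof -
  have "space G = space F" "space M = space F" "sets F \<subseteq> sets M" "sets G \<subseteq> sets M"
    using assms by (auto simp: subalgebra_def)
  then show ?thesis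
    using joint_algebra_least[of G F M] space_joint_algebra[of G F]
    unfolding subalgebra_def by blast
qed

lemma Int_stable_joint_generator:
  "Int_stable {A \<inter> B | A B. A \<in> sets F \<and> B \<in> sets G}"
proof (rule Int_stableI, clarsimp)
  fix A B A' B' assume "A \<in> sets F" "B \<in> sets G" "A' \<in> sets F" "B' \<in> sets G"
  then show "\<exists>Aa Ba. A \<inter> B \<inter> (A' \<inter> B') = Aa \<inter> Ba \<and> Aa \<in> sets F \<and> Ba \<in> sets G"
    by (intro exI[of _ "A \<inter> A'"] exI[of _ "B \<inter> B'"]) auto
qed

context prob_space
begin

lemma subalgebra_sigma_finite: "subalgebra M F \<Longrightarrow> sigma_finite_subalgebra M F"
  by (intro finite_measure_subalgebra_is_sigma_finite finite_measure_subalgebra.intro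
      finite_measure_subalgebra_axioms.intro finite_measure_axioms)

text \<open>Uniqueness of finite measures on an intersection-stable generator, for the measures with
  densities \<open>f\<close> and \<open>g\<close>: it is the only extension principle needed to pass from rectangles
  \<open>A \<inter> B\<close> to all events that mix the information of \<open>F\<close> and \<open>G\<close>.\<close>
lemma nn_integral_eq_on_joint:
  fixes f g :: "'a \<Rightarrow> ennreal"
  assumes F: "subalgebra M F" and G: "subalgebra M G"
    and [measurable]: "f \<in> borel_measurable M" "g \<in> borel_measurable M"
    and fin: "(\<integral>\<^sup>+x. f x \<partial>M) \<noteq> \<infinity>"
    and eq: "\<And>A B. A \<in> sets F \<Longrightarrow> B \<in> sets G \<Longrightarrow>
      (\<integral>\<^sup>+x. indicator (A \<inter> B) x * f x \<partial>M) = (\<integral>\<^sup>+x. indicator (A \<inter> B) x * g x \<partial>M)"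
    and A: "A \<in> sets (joint_algebra F G)"
  shows "(\<integral>\<^sup>+x. indicator A x * f x \<partial>M) = (\<integral>\<^sup>+x. indicator A x * g x \<partial>M)"
proof -
  have sp: "space G = space F" "space F = space M" using F G by (auto simp: subalgebra_def)
  have J: "subalgebra M (joint_algebra F G)" by (rule subalgebra_joint[OF F G])
  have dens: "subalgebra (density M h) (joint_algebra F G)" for h
    using J by (simp add: subalgebra_def)
  let ?R = "\<lambda>h. restr_to_subalg (density M h) (joint_algebra F G)"
  have val: "emeasure (?R h) A = (\<integral>\<^sup>+x. indicator A x * h x \<partial>M)"
    if "A \<in> sets (joint_algebra F G)" and [measurable]: "h \<in> borel_measurable M" for A h
  proof -
    have "A \<in> sets M" using that J by (auto simp: subalgebra_def)
    then show ?thesis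
      using that by (simp add: emeasure_restr_to_subalg[OF dens] emeasure_density mult.commute)
  qed
  have "?R f = ?R g"
  proof (rule measure_eqI_generator_eq[OF Int_stable_joint_generator[of F G], where \<Omega> = "space F"
        and A = "\<lambda>_. space F"])
    show "{A \<inter> B |A B. A \<in> sets F \<and> B \<in> sets G} \<subseteq> Pow (space F)"
      by (rule joint_generator_subset) (rule sp)
    show "sets (?R f) = sigma_sets (space F) {A \<inter> B |A B. A \<in> sets F \<and> B \<in> sets G}"
      "sets (?R g) = sigma_sets (space F) {A \<inter> B |A B. A \<in> sets F \<and> B \<in> sets G}"
      using sp by (simp_all add: sets_restr_to_subalg[OF dens] sets_joint_algebra)
    show "range (\<lambda>_. space F) \<subseteq> {A \<inter> B |A B. A \<in> sets F \<and> B \<in> sets G}"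
      using sp sets.top[of F] sets.top[of G] by force
    have "space F \<in> sets (joint_algebra F G)"
      using sp by (metis sets.top space_joint_algebra)
    then have "emeasure (?R f) (space F) = (\<integral>\<^sup>+x. indicator (space F) x * f x \<partial>M)"
      by (rule val) simp
    also have "\<dots> = (\<integral>\<^sup>+x. f x \<partial>M)"
      using sp by (intro nn_integral_cong) simp
    finally show "emeasure (?R f) (space F) \<noteq> \<infinity>" for i :: nat using fin by simp
    fix X assume "X \<in> {A \<inter> B |A B. A \<in> sets F \<and> B \<in> sets G}"
    then obtain A B where AB: "X = A \<inter> B" "A \<in> sets F" "B \<in> sets G" by auto
    show "emeasure (?R f) X = emeasure (?R g) X"
      unfolding AB(1) using eq[OF AB(2,3)] joint_algebra_basic[OF sp(1) AB(2,3)]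
      by (simp add: val)
  qed auto
  then show ?thesis using val[OF A, of f] val[OF A, of g] by simp
qed

text \<open>The conditional probability of \<open>S\<close> given the independent algebra \<open>G2\<close> is the constant
  \<open>emeasure M S\<close>, so it can be pulled out of the integral against any \<open>G2\<close>-measurable weight.\<close>
lemma nn_integral_indep_indicator:
  fixes h :: "'a \<Rightarrow> ennreal"
  assumes ind: "indep_set (sets G1) (sets G2)" and G2: "subalgebra M G2"
    and S: "S \<in> sets G1" and h: "h \<in> borel_measurable G2"
  shows "(\<integral>\<^sup>+x. indicator S x * h x \<partial>M) = emeasure M S * (\<integral>\<^sup>+x. h x \<partial>M)"
proof -
  interpret G2: sigma_finite_subalgebra M G2 by (rule subalgebra_sigma_finite[OF G2])
  have ev: "S \<in> events" "sets G2 \<subseteq> events"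
    using indep_setD_ev1[OF ind] indep_setD_ev2[OF ind] S by auto
  have hM [measurable]: "h \<in> borel_measurable M" by (rule measurable_from_subalg[OF G2 h])
  have [measurable]: "S \<in> sets M" by fact
  have "AE x in M. emeasure M S = nn_cond_exp M G2 (indicator S) x"
  proof (rule G2.nn_cond_exp_charact)
    fix A assume A: "A \<in> sets G2"
    have "A \<in> sets M" using A ev by auto
    have "(\<integral>\<^sup>+x\<in>A. indicator S x \<partial>M) = emeasure M (S \<inter> A)"
      using \<open>A \<in> sets M\<close> by (simp flip: indicator_inter_arith)
    also have "\<dots> = emeasure M S * emeasure M A"
      using indep_setD[OF ind S A] by (simp add: emeasure_eq_measure ennreal_mult)
    finally show "(\<integral>\<^sup>+x\<in>A. indicator S x \<partial>M) = (\<integral>\<^sup>+x\<in>A. emeasure M S \<partial>M)"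
      using \<open>A \<in> sets M\<close> by (simp add: nn_integral_cmult_indicator)
  qed auto
  then have "(\<integral>\<^sup>+x. h x * nn_cond_exp M G2 (indicator S) x \<partial>M) = (\<integral>\<^sup>+x. h x * emeasure M S \<partial>M)"
    by (intro nn_integral_cong_AE) auto
  then show ?thesis
    using G2.nn_cond_exp_intg[OF h, of "indicator S"]
    by (simp add: nn_integral_multc mult.commute)
qed

text \<open>
  Revealing a statistic \<open>F1\<close> of one independent source \<open>G1\<close> and a statistic \<open>F2\<close> of the other
  source \<open>G2\<close> creates no dependence, not even between events that may also use the
  statistic of the opposite source. That extra freedom matters below: the innovations on one
  side are bounded by thresholds that involve observed values explained by the other side.

  The identity \<open>E[1\<^sub>S 1\<^sub>T] = E[1\<^sub>S P(T|F)]\<close> is extended in two rounds. It holds for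
  rectangles \<open>S = A \<inter> B\<close> with \<open>A \<in> G1\<close>, \<open>B \<in> F2\<close> and \<open>T \<in> G2\<close> because \<open>P(T|F2)\<close> is
  \<open>G2\<close>-measurable; this also shows that \<open>P(T|F2)\<close> is a version of \<open>P(T|F)\<close>. The identity is
  symmetric in \<open>S\<close> and \<open>T\<close>, so the second round fixes \<open>S\<close> and extends \<open>T\<close>.
\<close>
lemma cond_prob_joint_indep:
  assumes G1: "subalgebra M G1" and G2: "subalgebra M G2"
    and ind: "indep_set (sets G1) (sets G2)"
    and F1: "subalgebra G1 F1" and F2: "subalgebra G2 F2" and F: "subalgebra M F"
    and F12: "sets F1 \<subseteq> sets F" "sets F2 \<subseteq> sets F" "sets F \<subseteq> sets (joint_algebra F1 F2)"
    and S: "S \<in> sets (joint_algebra G1 F2)" and T: "T \<in> sets (joint_algebra G2 F1)"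
  shows "AE x in M. nn_cond_exp M F (indicator (S \<inter> T)) x =
    nn_cond_exp M F (indicator S) x * nn_cond_exp M F (indicator T) x"
proof -
  have sp: "space G1 = space M" "space G2 = space M" "space F1 = space M" "space F2 = space M"
    "space F = space M"
    using G1 G2 F1 F2 F by (auto simp: subalgebra_def)
  have sub: "subalgebra M F1" "subalgebra M F2"
    using G1 G2 F1 F2 by (auto simp: subalgebra_def)
  interpret F: sigma_finite_subalgebra M F by (rule subalgebra_sigma_finite[OF F])
  interpret F2: sigma_finite_subalgebra M F2 by (rule subalgebra_sigma_finite[OF sub(2)])
  have incl: "sets F \<subseteq> sets (joint_algebra G1 F2)" "sets F \<subseteq> sets (joint_algebra G2 F1)"
    "sets (joint_algebra G1 F2) \<subseteq> sets M" "sets (joint_algebra G2 F1) \<subseteq> sets M"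
  proof -
    have "sets (joint_algebra F1 F2) \<subseteq> sets (joint_algebra G1 F2)"
      using joint_algebra_upper[of F2 G1] F1 sp
      by (intro joint_algebra_least) (auto simp: subalgebra_def space_joint_algebra)
    then show "sets F \<subseteq> sets (joint_algebra G1 F2)" using F12 by auto
    have "sets (joint_algebra F1 F2) \<subseteq> sets (joint_algebra G2 F1)"
      using joint_algebra_upper[of F1 G2] F2 sp
      by (intro joint_algebra_least) (auto simp: subalgebra_def space_joint_algebra)
    then show "sets F \<subseteq> sets (joint_algebra G2 F1)" using F12 by auto
    show "sets (joint_algebra G1 F2) \<subseteq> sets M" "sets (joint_algebra G2 F1) \<subseteq> sets M"
      using subalgebra_joint[OF G1 sub(2)] subalgebra_joint[OF G2 sub(1)]
      by (simp_all add: subalgebra_def)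
  qed
  have fin: "(\<integral>\<^sup>+x. indicator A x \<partial>M) \<noteq> \<infinity>" if "A \<in> sets M" for A
    using that by simp
  let ?p = "\<lambda>A. nn_cond_exp M F (indicator A)"
  \<comment> \<open>First round: \<open>S'\<close> mixes \<open>G1\<close> with \<open>F2\<close>, while \<open>T'\<close> depends on \<open>G2\<close> alone.\<close>
  have one: "(\<integral>\<^sup>+x. indicator S' x * indicator T' x \<partial>M) = (\<integral>\<^sup>+x. indicator S' x * ?p T' x \<partial>M)"
    if T': "T' \<in> sets G2" and S': "S' \<in> sets (joint_algebra G1 F2)" for S' T'
  proof -
    have [measurable]: "T' \<in> sets M" using T' G2 by (auto simp: subalgebra_def)
    let ?q = "nn_cond_exp M F2 (indicator T')"
    have q: "(\<integral>\<^sup>+x. indicator R x * indicator T' x \<partial>M) = (\<integral>\<^sup>+x. indicator R x * ?q x \<partial>M)"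
      if "R \<in> sets (joint_algebra G1 F2)" for R
    proof (rule nn_integral_eq_on_joint[OF G1 sub(2) _ _ _ _ that])
      fix A B assume A: "A \<in> sets G1" and B: "B \<in> sets F2"
      have B2: "B \<in> sets G2" using B F2 by (auto simp: subalgebra_def)
      have q2: "?q \<in> borel_measurable G2" by (rule measurable_from_subalg[OF F2]) simp
      have "(\<integral>\<^sup>+x. indicator (A \<inter> B) x * indicator T' x \<partial>M) =
          (\<integral>\<^sup>+x. indicator A x * (indicator B x * indicator T' x) \<partial>M)"
        by (simp add: indicator_inter_arith mult.assoc)
      also have "\<dots> = emeasure M A * (\<integral>\<^sup>+x. indicator B x * indicator T' x \<partial>M)"
        using T' B2 by (intro nn_integral_indep_indicator[OF ind G2 A]) simp
      also have "(\<integral>\<^sup>+x. indicator B x * indicator T' x \<partial>M) = (\<integral>\<^sup>+x. indicator B x * ?q x \<partial>M)"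
        using B by (intro F2.nn_cond_exp_intg[symmetric]) auto
      also have "emeasure M A * \<dots> = (\<integral>\<^sup>+x. indicator A x * (indicator B x * ?q x) \<partial>M)"
        using B2 q2 by (intro nn_integral_indep_indicator[OF ind G2 A, symmetric]) simp
      finally show "(\<integral>\<^sup>+x. indicator (A \<inter> B) x * indicator T' x \<partial>M) =
          (\<integral>\<^sup>+x. indicator (A \<inter> B) x * ?q x \<partial>M)"
        by (simp add: indicator_inter_arith mult.assoc)
    qed (use fin in auto)
    have qF: "?q \<in> borel_measurable F"
      using F12 sp by (intro measurable_from_subalg[of F F2]) (auto simp: subalgebra_def)
    have "(\<integral>\<^sup>+x\<in>A. indicator T' x \<partial>M) = (\<integral>\<^sup>+x\<in>A. ?q x \<partial>M)" if "A \<in> sets F" for A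
      using q[of A] incl that by (auto simp: mult.commute)
    then have "AE x in M. ?q x = ?p T' x"
      by (rule F.nn_cond_exp_charact) (auto intro: qF)
    then have "(\<integral>\<^sup>+x. indicator S' x * ?q x \<partial>M) = (\<integral>\<^sup>+x. indicator S' x * ?p T' x \<partial>M)"
      by (intro nn_integral_cong_AE) auto
    then show ?thesis using q[OF S'] by simp
  qed
  have SM [measurable]: "S \<in> sets M" and TM [measurable]: "T \<in> sets M" using S T incl by auto
  \<comment> \<open>Second round: the factor from \<open>F1\<close> is moved over to \<open>S\<close>, where the first round applies.\<close>
  have two: "(\<integral>\<^sup>+x. indicator R x * indicator S x \<partial>M) = (\<integral>\<^sup>+x. indicator R x * ?p S x \<partial>M)"
    if "R \<in> sets (joint_algebra G2 F1)" for R
  proof (rule nn_integral_eq_on_joint[OF G2 sub(1) _ _ _ _ that])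
    fix A B assume A: "A \<in> sets G2" and B: "B \<in> sets F1"
    have [measurable]: "A \<in> sets M" using A G2 by (auto simp: subalgebra_def)
    have BF [measurable]: "B \<in> sets F" using B F12 by auto
    have SB: "S \<inter> B \<in> sets (joint_algebra G1 F2)" using S subsetD[OF incl(1) BF] by (rule sets.Int)
    have "(\<integral>\<^sup>+x. indicator (A \<inter> B) x * indicator S x \<partial>M) =
        (\<integral>\<^sup>+x. indicator (S \<inter> B) x * indicator A x \<partial>M)"
      by (simp add: indicator_inter_arith mult_ac)
    also have "\<dots> = (\<integral>\<^sup>+x. indicator (S \<inter> B) x * ?p A x \<partial>M)"
      by (rule one[OF A SB])
    also have "\<dots> = (\<integral>\<^sup>+x. (indicator B x * ?p A x) * indicator S x \<partial>M)"
      by (simp add: indicator_inter_arith mult_ac)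
    also have "\<dots> = (\<integral>\<^sup>+x. (indicator B x * ?p A x) * ?p S x \<partial>M)"
      by (intro F.nn_cond_exp_intg[symmetric]) auto
    also have "\<dots> = (\<integral>\<^sup>+x. (indicator B x * ?p S x) * ?p A x \<partial>M)"
      by (simp add: mult_ac)
    also have "\<dots> = (\<integral>\<^sup>+x. (indicator B x * ?p S x) * indicator A x \<partial>M)"
      by (intro F.nn_cond_exp_intg) auto
    finally show "(\<integral>\<^sup>+x. indicator (A \<inter> B) x * indicator S x \<partial>M) =
        (\<integral>\<^sup>+x. indicator (A \<inter> B) x * ?p S x \<partial>M)"
      by (simp add: indicator_inter_arith mult_ac)
  qed (use fin in auto)
  have "AE x in M. ?p S x * ?p T x = ?p (S \<inter> T) x"
  proof (rule F.nn_cond_exp_charact)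
    fix A assume A [measurable]: "A \<in> sets F"
    have TA: "T \<inter> A \<in> sets (joint_algebra G2 F1)" using T subsetD[OF incl(2) A] by (rule sets.Int)
    have "(\<integral>\<^sup>+x\<in>A. indicator (S \<inter> T) x \<partial>M) = (\<integral>\<^sup>+x. indicator (T \<inter> A) x * indicator S x \<partial>M)"
      by (simp add: indicator_inter_arith mult_ac)
    also have "\<dots> = (\<integral>\<^sup>+x. indicator (T \<inter> A) x * ?p S x \<partial>M)"
      by (rule two[OF TA])
    also have "\<dots> = (\<integral>\<^sup>+x. (indicator A x * ?p S x) * indicator T x \<partial>M)"
      by (simp add: indicator_inter_arith mult_ac)
    also have "\<dots> = (\<integral>\<^sup>+x. (indicator A x * ?p S x) * ?p T x \<partial>M)"
      by (intro F.nn_cond_exp_intg[symmetric]) auto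
    finally show "(\<integral>\<^sup>+x\<in>A. indicator (S \<inter> T) x \<partial>M) = (\<integral>\<^sup>+x\<in>A. ?p S x * ?p T x \<partial>M)"
      by (simp add: mult_ac)
  qed auto
  then show ?thesis by auto
qed

end

section \<open>Conditioning on variables that agree on an event\<close>

context prob_space
begin

lemma subalgebra_vimage: "X \<in> measurable M N \<Longrightarrow> subalgebra M (vimage_algebra (space M) X N)"
  using sets_image_in_sets[of M "space M" X N] by (simp add: subalgebra_def)

text \<open>A conditional expectation given \<open>X\<close> is a function of the value of \<open>X\<close>. The function is
  obtained directly as the density of the image of \<open>f\<close> times \<open>M\<close> with respect to the law of
  \<open>X\<close>. It is needed because another random variable \<open>Y\<close> will be substituted for \<open>X\<close>.\<close>
lemma nn_cond_exp_factor:
  assumes X [measurable]: "X \<in> measurable M N" and f [measurable]: "f \<in> borel_measurable M"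
  obtains u where "u \<in> borel_measurable N"
    and "AE x in M. nn_cond_exp M (vimage_algebra (space M) X N) f x = u (X x)"
proof -
  let ?F = "vimage_algebra (space M) X N"
  interpret F: sigma_finite_subalgebra M ?F
    by (rule subalgebra_sigma_finite[OF subalgebra_vimage[OF X]])
  have Xs: "X \<in> space M \<rightarrow> space N" using X by (rule measurable_space[THEN funcsetI])
  let ?D = "distr M N X" and ?D' = "distr (density M f) N X"
  interpret D: prob_space ?D by (rule prob_space_distr[OF X])
  have [measurable]: "X \<in> measurable (density M f) N" by simp
  have val: "emeasure ?D' B = (\<integral>\<^sup>+x. f x * indicator (X -` B \<inter> space M) x \<partial>M)" if "B \<in> sets N" for B
    using that by (simp add: emeasure_distr emeasure_density)
  have ac: "absolutely_continuous ?D ?D'"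
    unfolding absolutely_continuous_def
  proof
    fix B assume "B \<in> null_sets ?D"
    then have B: "B \<in> sets N" "emeasure M (X -` B \<inter> space M) = 0"
      by (auto simp: null_sets_def emeasure_distr)
    have "X -` B \<inter> space M \<in> null_sets M" using B by (auto simp: null_sets_def)
    then have "AE x in M. f x * indicator (X -` B \<inter> space M) x = 0"
      by (rule AE_I') (auto split: split_indicator_asm)
    then have "emeasure ?D' B = 0"
      using B(1) by (simp add: val nn_integral_0_iff_AE del: indicator_simps)
    then show "B \<in> null_sets ?D'" using B by (auto simp: null_sets_def)
  qed
  define u where "u = RN_deriv ?D ?D'"
  have u [measurable]: "u \<in> borel_measurable N"
    using borel_measurable_RN_deriv[of ?D ?D'] by (simp add: u_def)
  have dens: "density ?D u = ?D'" unfolding u_def by (rule D.density_RN_deriv[OF ac]) simp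
  have uF: "(\<lambda>x. u (X x)) \<in> borel_measurable ?F"
    by (rule measurable_compose[OF measurable_vimage_algebra1[OF Xs] u])
  have "(\<integral>\<^sup>+x\<in>A. f x \<partial>M) = (\<integral>\<^sup>+x\<in>A. u (X x) \<partial>M)" if A': "A \<in> sets ?F" for A
  proof -
    obtain B where B [measurable]: "B \<in> sets N" and A: "A = X -` B \<inter> space M"
      using Xs A' by (auto simp: sets_vimage_algebra2)
    have "(\<integral>\<^sup>+x\<in>A. f x \<partial>M) = emeasure (density ?D u) B"
      unfolding dens A by (simp add: val)
    also have "\<dots> = (\<integral>\<^sup>+x. u (X x) * indicator B (X x) \<partial>M)"
      by (simp add: emeasure_density nn_integral_distr)
    also have "\<dots> = (\<integral>\<^sup>+x\<in>A. u (X x) \<partial>M)"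
      unfolding A by (intro nn_integral_cong) (auto split: split_indicator)
    finally show ?thesis .
  qed
  then have "AE x in M. u (X x) = nn_cond_exp M ?F f x"
    by (rule F.nn_cond_exp_charact) (auto intro: uF)
  then have "AE x in M. nn_cond_exp M ?F f x = u (X x)" by eventually_elim simp
  then show ?thesis by (rule that[OF u])
qed

text \<open>
  Bayes' rule for two conditionings that agree on an event: if \<open>X = Y\<close> on \<open>E\<close> and \<open>X\<close> decides
  whether \<open>E\<close> occurs, then on \<open>E\<close> conditioning on \<open>X\<close> amounts to conditioning on \<open>Y\<close> and on
  \<open>E\<close>, that is, \<open>E[f | X] = E[1\<^sub>E f | Y] / P(E | Y)\<close>. In general \<open>Y\<close> does not decide whether
  \<open>E\<close> occurs, whence the normalising factor.
\<close>
lemma nn_cond_exp_bayes_local: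
  assumes X [measurable]: "X \<in> measurable M N" and Y [measurable]: "Y \<in> measurable M N"
    and E: "E \<in> sets (vimage_algebra (space M) X N)"
    and XY: "AE x in M. x \<in> E \<longrightarrow> X x = Y x"
    and f [measurable]: "f \<in> borel_measurable M"
  shows "AE x in M. x \<in> E \<longrightarrow>
    nn_cond_exp M (vimage_algebra (space M) X N) f x
      * nn_cond_exp M (vimage_algebra (space M) Y N) (indicator E) x =
    nn_cond_exp M (vimage_algebra (space M) Y N) (\<lambda>x. indicator E x * f x) x"
proof -
  let ?F = "vimage_algebra (space M) X N" and ?G = "vimage_algebra (space M) Y N"
  interpret F: sigma_finite_subalgebra M ?F
    by (rule subalgebra_sigma_finite[OF subalgebra_vimage[OF X]])
  interpret G: sigma_finite_subalgebra M ?G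
    by (rule subalgebra_sigma_finite[OF subalgebra_vimage[OF Y]])
  have EM [measurable]: "E \<in> sets M" using E F.subalg by (auto simp: subalgebra_def)
  have Ys: "Y \<in> space M \<rightarrow> space N" using measurable_space[OF Y] by auto
  obtain u where u [measurable]: "u \<in> borel_measurable N"
    and pu: "AE x in M. nn_cond_exp M ?F f x = u (X x)"
    using nn_cond_exp_factor[OF X f] .
  have uY [measurable]: "(\<lambda>x. u (Y x)) \<in> borel_measurable ?G"
    by (rule measurable_compose[OF measurable_vimage_algebra1[OF Ys] u])
  have "AE x in M. u (Y x) * nn_cond_exp M ?G (indicator E) x =
      nn_cond_exp M ?G (\<lambda>x. indicator E x * f x) x"
  proof (rule G.nn_cond_exp_charact)
    fix A assume A: "A \<in> sets ?G"
    then obtain B where B [measurable]: "B \<in> sets N" and AB: "A = Y -` B \<inter> space M"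
      using Ys by (auto simp: sets_vimage_algebra2)
    have XB: "X -` B \<inter> space M \<in> sets ?F" using B by (rule in_vimage_algebra)
    have AM [measurable]: "A \<in> sets M" unfolding AB by simp
    have "(\<integral>\<^sup>+x\<in>A. u (Y x) * nn_cond_exp M ?G (indicator E) x \<partial>M) =
        (\<integral>\<^sup>+x. (indicator A x * u (Y x)) * nn_cond_exp M ?G (indicator E) x \<partial>M)"
      by (simp add: mult_ac)
    also have "\<dots> = (\<integral>\<^sup>+x. (indicator A x * u (Y x)) * indicator E x \<partial>M)"
      using A by (intro G.nn_cond_exp_intg) auto
    also have "\<dots> = (\<integral>\<^sup>+x. indicator (X -` B \<inter> space M \<inter> E) x * nn_cond_exp M ?F f x \<partial>M)"
      using XY pu unfolding AB
      by (intro nn_integral_cong_AE) (auto split: split_indicator elim!: eventually_elim2)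
    also have "\<dots> = (\<integral>\<^sup>+x. indicator (X -` B \<inter> space M \<inter> E) x * f x \<partial>M)"
      using XB E by (intro F.nn_cond_exp_intg) auto
    also have "\<dots> = (\<integral>\<^sup>+x\<in>A. indicator E x * f x \<partial>M)"
      using XY unfolding AB
      by (intro nn_integral_cong_AE) (auto split: split_indicator elim!: eventually_mono)
    finally show "(\<integral>\<^sup>+x\<in>A. indicator E x * f x \<partial>M) =
      (\<integral>\<^sup>+x\<in>A. u (Y x) * nn_cond_exp M ?G (indicator E) x \<partial>M)" by simp
  qed auto
  then show ?thesis using pu XY by eventually_elim auto
qed

lemma cond_prob_pos:
  assumes F: "subalgebra M F" and E [measurable]: "E \<in> sets M"
  shows "AE x in M. x \<in> E \<longrightarrow> nn_cond_exp M F (indicator E) x \<noteq> 0"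
proof -
  interpret F: sigma_finite_subalgebra M F by (rule subalgebra_sigma_finite[OF F])
  let ?q = "nn_cond_exp M F (indicator E)"
  have [measurable]: "Measurable.pred F (\<lambda>x. ?q x = 0)" by simp
  have Z: "{x \<in> space F. ?q x = 0} \<in> sets F" by measurable
  then have [measurable]: "{x \<in> space F. ?q x = 0} \<in> sets M"
    using F by (auto simp: subalgebra_def)
  have "(\<integral>\<^sup>+x. indicator {x \<in> space F. ?q x = 0} x * indicator E x \<partial>M) =
      (\<integral>\<^sup>+x. indicator {x \<in> space F. ?q x = 0} x * ?q x \<partial>M)"
    using Z by (intro F.nn_cond_exp_intg[symmetric]) auto
  also have "\<dots> = (\<integral>\<^sup>+x. 0 \<partial>M)" by (intro nn_integral_cong) (auto split: split_indicator)
  finally have "(\<integral>\<^sup>+x. indicator {x \<in> space F. ?q x = 0} x * indicator E x \<partial>M) = 0"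
    by simp
  then have "AE x in M. indicator {x \<in> space F. ?q x = 0} x * indicator E x = (0::ennreal)"
    by (rule nn_integral_0_iff_AE[THEN iffD1, rotated]) simp
  then show ?thesis
  proof (rule AE_mp, intro AE_I2 impI notI)
    fix x assume "x \<in> space M" "x \<in> E" "?q x = 0"
      and 0: "indicator {x \<in> space F. ?q x = 0} x * indicator E x = (0::ennreal)"
    moreover have "space F = space M" using F by (simp add: subalgebra_def)
    ultimately show False by simp
  qed
qed

lemma cond_prob_le_1:
  assumes F: "subalgebra M F" and E [measurable]: "E \<in> sets M"
  shows "AE x in M. nn_cond_exp M F (indicator E) x \<le> 1"
proof -
  interpret F: sigma_finite_subalgebra M F by (rule subalgebra_sigma_finite[OF F])
  have "AE x in M. nn_cond_exp M F (indicator E) x \<le> nn_cond_exp M F (\<lambda>_. 1) x"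
    by (intro F.nn_cond_exp_mono) (auto split: split_indicator)
  moreover have "AE x in M. 1 = nn_cond_exp M F (\<lambda>_. 1) x"
    by (rule F.nn_cond_exp_F_meas) auto
  ultimately show ?thesis by eventually_elim simp
qed

text \<open>
  On \<open>E\<close> the observation \<open>X\<close> coincides with a vector \<open>Y\<close> composed of one statistic of each of
  two independent sources, and \<open>E\<close> itself splits into a constraint \<open>E1\<close> on the first source and
  a constraint \<open>E2\<close> on the second one, both relative to \<open>Y\<close>. By Bayes' rule the conditional
  probabilities given \<open>X\<close> are quotients of conditional probabilities given \<open>Y\<close>. All of these
  factorise over the two sources, and the normalising constants \<open>P(E1 | Y) P(E2 | Y)\<close> cancel.
\<close>
lemma cond_prob_product_local:
  assumes X: "X \<in> measurable M N" and Y: "Y \<in> measurable M N"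
    and G1: "subalgebra M G1" and G2: "subalgebra M G2"
    and ind: "indep_set (sets G1) (sets G2)"
    and F1: "subalgebra G1 F1" and F2: "subalgebra G2 F2"
    and F12: "sets F1 \<subseteq> sets (vimage_algebra (space M) Y N)"
      "sets F2 \<subseteq> sets (vimage_algebra (space M) Y N)"
      "Y \<in> measurable (joint_algebra F1 F2) N"
    and E: "E \<in> sets (vimage_algebra (space M) X N)"
    and XY: "AE x in M. x \<in> E \<longrightarrow> X x = Y x"
    and E12: "E1 \<in> sets (joint_algebra G1 F2)" "E2 \<in> sets (joint_algebra G2 F1)"
      "AE x in M. x \<in> E \<longleftrightarrow> x \<in> E1 \<inter> E2"
    and A: "A \<in> events" "A' \<in> sets (joint_algebra G1 F2)"
      "AE x in M. x \<in> E \<longrightarrow> (x \<in> A \<longleftrightarrow> x \<in> A')"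
    and B: "B \<in> events" "B' \<in> sets (joint_algebra G2 F1)"
      "AE x in M. x \<in> E \<longrightarrow> (x \<in> B \<longleftrightarrow> x \<in> B')"
  defines "F \<equiv> vimage_algebra (space M) X N"
  shows "AE x in M. x \<in> E \<longrightarrow>
    nn_cond_exp M F (indicator (A \<inter> B)) x =
    nn_cond_exp M F (indicator A) x * nn_cond_exp M F (indicator B) x"
proof -
  let ?F = "vimage_algebra (space M) X N" and ?G = "vimage_algebra (space M) Y N"
  have subG: "subalgebra M ?G" by (rule subalgebra_vimage[OF Y])
  interpret G: sigma_finite_subalgebra M ?G by (rule subalgebra_sigma_finite[OF subG])
  have sub: "subalgebra M F1" "subalgebra M F2"
    using G1 G2 F1 F2 by (auto simp: subalgebra_def)
  have J: "sets (joint_algebra G1 F2) \<subseteq> sets M" "sets (joint_algebra G2 F1) \<subseteq> sets M"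
    using subalgebra_joint[OF G1 sub(2)] subalgebra_joint[OF G2 sub(1)]
    by (simp_all add: subalgebra_def)
  have EM [measurable]: "E \<in> events" "A \<in> events" "B \<in> events" "A' \<in> events" "B' \<in> events"
    "E1 \<in> events" "E2 \<in> events"
    using E A B E12 J subalgebra_vimage[OF X] by (auto simp: subalgebra_def)
  have GJ: "sets ?G \<subseteq> sets (joint_algebra F1 F2)"
  proof (rule sets_image_in_sets)
    show "space (joint_algebra F1 F2) = space M"
      using sub by (simp add: space_joint_algebra subalgebra_def)
  qed (rule F12)
  note CI = cond_prob_joint_indep[OF G1 G2 ind F1 F2 subG F12(1,2) GJ]
  let ?p = "\<lambda>A. nn_cond_exp M ?F (indicator A)" and ?q = "\<lambda>A. nn_cond_exp M ?G (indicator A)"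
  have bayes: "AE x in M. x \<in> E \<longrightarrow> ?p S x * ?q E x = ?q (E \<inter> S) x" if "S \<in> events" for S
    using nn_cond_exp_bayes_local[OF X Y E XY, of "indicator S"] that
    by (simp add: indicator_inter_arith[symmetric] fun_eq_iff)
  have cong: "AE x in M. ?q S x = ?q T x"
    if "AE x in M. x \<in> S \<longleftrightarrow> x \<in> T" "S \<in> events" "T \<in> events" for S T
    using that by (intro G.nn_cond_exp_cong) (auto split: split_indicator elim!: eventually_mono)
  have 1: "AE x in M. ?q E x = ?q (E1 \<inter> E2) x"
    using E12(3) by (intro cong) auto
  have 2: "AE x in M. ?q (E \<inter> (A \<inter> B)) x = ?q ((A' \<inter> E1) \<inter> (B' \<inter> E2)) x"
    by (intro cong) (use E12(3) A(3) B(3) in \<open>auto elim: AE_mp\<close>)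
  have 3: "AE x in M. ?q (E \<inter> A) x = ?q ((A' \<inter> E1) \<inter> E2) x"
    by (intro cong) (use E12(3) A(3) in \<open>auto elim: AE_mp\<close>)
  have 4: "AE x in M. ?q (E \<inter> B) x = ?q (E1 \<inter> (B' \<inter> E2)) x"
    by (intro cong) (use E12(3) B(3) in \<open>auto elim: AE_mp\<close>)
  have A1: "A' \<inter> E1 \<in> sets (joint_algebra G1 F2)" using A(2) E12(1) by (rule sets.Int)
  have B2: "B' \<inter> E2 \<in> sets (joint_algebra G2 F1)" using B(2) E12(2) by (rule sets.Int)
  have 5: "AE x in M. x \<in> E \<longrightarrow> ?p (A \<inter> B) x * ?q E x = ?q (E \<inter> (A \<inter> B)) x"
    by (rule bayes) simp
  have pAB: "AE x in M. x \<in> E \<longrightarrow> ?p (A \<inter> B) x * ?q E x = ?q (A' \<inter> E1) x * ?q (B' \<inter> E2) x"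
    using 5 2 CI[OF A1 B2] by eventually_elim simp
  have pA: "AE x in M. x \<in> E \<longrightarrow> ?p A x * ?q E x = ?q (A' \<inter> E1) x * ?q E2 x"
    using bayes[OF EM(2)] 3 CI[OF A1 E12(2)] by eventually_elim simp
  have pB: "AE x in M. x \<in> E \<longrightarrow> ?p B x * ?q E x = ?q E1 x * ?q (B' \<inter> E2) x"
    using bayes[OF EM(3)] 4 CI[OF E12(1) B2] by eventually_elim simp
  have qE: "AE x in M. ?q E x = ?q E1 x * ?q E2 x"
    using 1 CI[OF E12(1,2)] by eventually_elim simp
  show ?thesis
    unfolding F_def
    using pAB pA pB qE cond_prob_pos[OF subG EM(1)] cond_prob_le_1[OF subG EM(1)]
  proof eventually_elim
    case (elim x)
    show ?case
    proof
      assume xE: "x \<in> E"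
      define q where "q = ?q E x"
      have q: "q = ?q E1 x * ?q E2 x" "q \<noteq> 0" "q \<noteq> \<top>"
        using elim xE by (auto simp: q_def top_unique simp del: mult_eq_0_iff)
      have "(?p A x * ?p B x) * (q * q) = (?p A x * q) * (?p B x * q)"
        by (simp only: mult_ac)
      also have "\<dots> = (?q (A' \<inter> E1) x * ?q E2 x) * (?q E1 x * ?q (B' \<inter> E2) x)"
        using elim xE by (simp add: q_def)
      also have "\<dots> = (?q (A' \<inter> E1) x * ?q (B' \<inter> E2) x) * q"
        unfolding q(1) by (simp only: mult_ac)
      also have "\<dots> = (?p (A \<inter> B) x * q) * q"
        using elim xE by (simp add: q_def)
      also have "\<dots> = ?p (A \<inter> B) x * (q * q)" by (simp only: mult_ac)
      finally have eq: "(?p A x * ?p B x) * (q * q) = ?p (A \<inter> B) x * (q * q)" .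
      have "q * q \<noteq> 0" "q * q \<noteq> \<top>" using q by (auto simp: ennreal_mult_eq_top_iff)
      then show "?p (A \<inter> B) x = ?p A x * ?p B x"
        by (metis eq mult_divide_eq_ennreal)
    qed
  qed
qed

lemma real_cond_exp_indicator:
  assumes F: "subalgebra M F" and S [measurable]: "S \<in> sets M"
  shows "AE x in M. real_cond_exp M F (indicator S) x = enn2real (nn_cond_exp M F (indicator S) x)"
proof -
  interpret F: sigma_finite_subalgebra M F by (rule subalgebra_sigma_finite[OF F])
  have "AE x in M. 0 = nn_cond_exp M F (\<lambda>x. ennreal (- indicator S x)) x"
    by (intro F.nn_cond_exp_charact)
       (auto simp: ennreal_neg intro!: nn_integral_zero' split: split_indicator)
  then show ?thesis
    by eventually_elim (simp add: real_cond_exp_def ennreal_indicator)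
qed

end

section \<open>Unrolling the recursion down to the observed nodes\<close>

lemma pawalk_verts_snoc:
  "pcas u p a \<Longrightarrow> pawalk_verts u (p @ [(a, i)]) = pawalk_verts u p @ [i]"
  by (induction p arbitrary: u) auto

text \<open>The defining recursion at a single outcome, together with positivity of the
  innovations \<open>z\<close>.\<close>
definition solves :: "'v pair_pre_digraph \<Rightarrow> ('v \<Rightarrow> 'v \<Rightarrow> real) \<Rightarrow> ('v \<Rightarrow> real) \<Rightarrow> ('v \<Rightarrow> real) \<Rightarrow> bool" where
  "solves D C z x \<longleftrightarrow> (\<forall>i\<in>pverts D. z i > 0 \<and>
     x i = Max (insert (z i) {C i j * x j | j. (j, i) \<in> parcs D}))"

text \<open>
  The recursion for node \<open>i\<close>, unrolled until an observed node is met: \<open>x i\<close> is the maximum of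
  the weighted innovations \<open>wi j * z j\<close> and of the weighted observed values \<open>vi l * x l\<close>. It is
  stated as upper bounds plus attainment by a term of positive weight, since these are the two
  facts that get used.
\<close>
definition max_expansion where
  "max_expansion D C K i wi vi \<longleftrightarrow>
     (\<forall>j. wi j \<ge> 0) \<and> (\<forall>l. vi l \<ge> 0) \<and> wi i > 0 \<and>
     (\<forall>z x. solves D C z x \<longrightarrow>
        (\<forall>j\<in>pverts D. wi j * z j \<le> x i) \<and> (\<forall>l\<in>K. vi l * x l \<le> x i) \<and>
        ((\<exists>j\<in>pverts D. wi j > 0 \<and> x i = wi j * z j) \<or> (\<exists>l\<in>K. vi l > 0 \<and> x i = vi l * x l)))"

lemma solves_ge:
  assumes D: "pair_digraph D" and s: "solves D C z x" and i: "i \<in> pverts D"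
  shows "z i \<le> x i" "(a, i) \<in> parcs D \<Longrightarrow> C i a * x a \<le> x i"
    "x i = z i \<or> (\<exists>a. (a, i) \<in> parcs D \<and> x i = C i a * x a)" "x i > 0"
proof -
  interpret pair_digraph D by (rule D)
  let ?S = "{C i j * x j | j. (j, i) \<in> parcs D}"
  have "?S = (\<lambda>(j, i'). C i j * x j) ` {e \<in> parcs D. snd e = i}" by auto
  then have fin: "finite (insert (z i) ?S)" using pair_finite_arcs by simp
  have x: "x i = Max (insert (z i) ?S)" "z i > 0" using s i by (auto simp: solves_def)
  show 1: "z i \<le> x i" unfolding x(1) by (rule Max_ge[OF fin]) simp
  show "(a, i) \<in> parcs D \<Longrightarrow> C i a * x a \<le> x i" unfolding x(1) by (rule Max_ge[OF fin]) auto
  have "x i \<in> insert (z i) ?S" unfolding x(1) by (rule Max_in[OF fin]) simp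
  then show "x i = z i \<or> (\<exists>a. (a, i) \<in> parcs D \<and> x i = C i a * x a)" by auto
  show "x i > 0" using 1 x(2) by simp
qed

text \<open>The path meets \<open>K\<close> at most in its endpoint \<open>i\<close>. The last conjunct records that
  every node on it is an ancestor of \<open>i\<close>; by acyclicity a new endpoint is then automatically
  fresh, so extending the path keeps its nodes distinct.\<close>
definition unblocked where
  "unblocked D K j i \<longleftrightarrow> (\<exists>p. pre_digraph.apath (with_proj D) j p i \<and>
     set (pawalk_verts j p) \<inter> K \<subseteq> {i} \<and> (\<forall>u\<in>set (pawalk_verts j p). (u, i) \<in> (parcs D)\<^sup>*))"

lemma unblocked_refl:
  assumes "pair_digraph D" "i \<in> pverts D"
  shows "unblocked D K i i"
proof -
  interpret pair_digraph D by fact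
  show ?thesis unfolding unblocked_def
    by (rule exI[of _ "[]"]) (use assms(2) in \<open>auto simp: apath_Nil_iff\<close>)
qed

lemma unblocked_step:
  assumes "is_dag D" and ja: "unblocked D K j a" and ai: "(a, i) \<in> parcs D" and a: "a \<notin> K"
  shows "unblocked D K j i"
proof -
  interpret pair_digraph D using assms(1) by (simp add: is_dag_def)
  obtain p where p: "apath j p a" "set (pawalk_verts j p) \<inter> K \<subseteq> {a}"
    "\<forall>u\<in>set (pawalk_verts j p). (u, a) \<in> (parcs D)\<^sup>*"
    using ja unfolding unblocked_def by auto
  have w: "awalk j p a" "distinct (pawalk_verts j p)"
    using p(1) by (auto simp: apath_def)
  have verts: "pawalk_verts j (p @ [(a, i)]) = pawalk_verts j p @ [i]"
    using w(1) by (intro pawalk_verts_snoc) (auto simp: awalk_def)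
  have "awalk j (p @ [(a, i)]) i"
    using awalk_appendI[OF w(1)] arc_implies_awalk[OF ai] by simp
  moreover have "i \<notin> set (pawalk_verts j p)"
  proof
    assume "i \<in> set (pawalk_verts j p)"
    then have "(i, a) \<in> (parcs D)\<^sup>*" using p(3) by auto
    then have "(i, i) \<in> (parcs D)\<^sup>+" using ai by (rule rtrancl_into_trancl1)
    then show False using assms(1) by (auto simp: is_dag_def acyclic_def)
  qed
  ultimately have "apath j (p @ [(a, i)]) i"
    using w(2) by (auto simp: apath_def verts)
  then show ?thesis
    unfolding unblocked_def using p(2,3) a ai
    by (intro exI[of _ "p @ [(a, i)]"]) (auto simp: verts intro: rtrancl.rtrancl_into_rtrancl)
qed

lemma unblocked_cond_reach:
  assumes "unblocked D K j i" "j \<noteq> i"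
  shows "(j, i) \<in> parcs (cond_reach_dag D K)" "j \<notin> K"
proof -
  obtain p where p: "pre_digraph.apath (with_proj D) j p i" "set (pawalk_verts j p) \<inter> K \<subseteq> {i}"
    using assms(1) unfolding unblocked_def by auto
  then show "(j, i) \<in> parcs (cond_reach_dag D K)"
    using assms(2) by (auto simp: cond_reach_dag_def factors_through_def)
  have "j \<in> set (pawalk_verts j p)"
    using p(1)
    by (cases p) (auto simp: pre_digraph.apath_def pre_digraph.awalk_def cas_with_proj_eq)
  then show "j \<notin> K" using p(2) assms(2) by auto
qed

text \<open>
  Induction along the DAG. A parent in \<open>K\<close> contributes an observed term; a parent outside \<open>K\<close>
  is replaced by its own expansion scaled by the edge coefficient. The largest weight is kept for
  each innovation and each observed value, so an innovation has positive weight only if it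
  reaches \<open>i\<close> along a path avoiding \<open>K\<close>.
\<close>
lemma max_expansion_exists:
  assumes dag: "is_dag D" and C: "coeff_matrix D C" and i: "i \<in> pverts D"
  shows "\<exists>wi vi. max_expansion D C K i wi vi \<and> (\<forall>j. wi j > 0 \<longrightarrow> unblocked D K j i) \<and>
    (\<forall>l. vi l > 0 \<longrightarrow> l \<in> K \<and> (l, i) \<in> (parcs D)\<^sup>+)"
proof -
  have D: "pair_digraph D" and ac: "acyclic (parcs D)" using dag by (auto simp: is_dag_def)
  interpret pair_digraph D by (rule D)
  have "wf (parcs D)" using pair_finite_arcs ac by (rule finite_acyclic_wf)
  then show ?thesis using i
  proof (induction i rule: wf_induct_rule)
    case (less i)
    let ?Q = "\<lambda>i wi vi. max_expansion D C K i wi vi \<and> (\<forall>j. wi j > 0 \<longrightarrow> unblocked D K j i) \<and>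
      (\<forall>l. vi l > 0 \<longrightarrow> l \<in> K \<and> (l, i) \<in> (parcs D)\<^sup>+)"
    have "\<forall>a\<in>{a. (a, i) \<in> parcs D}. \<exists>wv. ?Q a (fst wv) (snd wv)"
      using less.IH in_arcsD1 by fastforce
    then obtain wv where wv: "\<forall>a\<in>{a. (a, i) \<in> parcs D}. ?Q a (fst (wv a)) (snd (wv a))"
      by (rule bchoice[THEN exE])
    define w v where "w = (\<lambda>a. fst (wv a))" and "v = (\<lambda>a. snd (wv a))"
    have IH: "max_expansion D C K a (w a) (v a)" "w a j > 0 \<Longrightarrow> unblocked D K j a"
      "v a l > 0 \<Longrightarrow> l \<in> K \<and> (l, a) \<in> (parcs D)\<^sup>+" if "(a, i) \<in> parcs D" for a j l
      using wv that by (auto simp: w_def v_def)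
    have wge: "w a j \<ge> 0" and vge: "v a l \<ge> 0" if "(a, i) \<in> parcs D" for a j l
      using IH(1)[OF that] by (auto simp: max_expansion_def)
    have Cge: "C i a \<ge> 0" if "(a, i) \<in> parcs D" for a
      using C in_arcsD1[OF that] less.prems unfolding coeff_matrix_def by blast
    define P where "P = {a. (a, i) \<in> parcs D} - K"
    have "P \<subseteq> fst ` parcs D" by (force simp: P_def)
    then have finP: "finite P" using pair_finite_arcs finite_surj by blast
    define wi where "wi = (\<lambda>j. Max (insert (if j = i then 1 else 0) ((\<lambda>a. C i a * w a j) ` P)))"
    define vi where "vi = (\<lambda>l. Max (insert (if l \<in> K \<and> (l, i) \<in> parcs D then C i l else 0)
      ((\<lambda>a. C i a * v a l) ` P)))"
    have wi_ge: "(if j = i then 1 else 0) \<le> wi j" "a \<in> P \<Longrightarrow> C i a * w a j \<le> wi j" for a j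
      unfolding wi_def using finP by (auto intro!: Max_ge)
    have vi_ge: "(if l \<in> K \<and> (l, i) \<in> parcs D then C i l else 0) \<le> vi l"
      "a \<in> P \<Longrightarrow> C i a * v a l \<le> vi l" for a l
      unfolding vi_def using finP by (auto intro!: Max_ge)
    have wi_in: "wi j = (if j = i then 1 else 0) \<or> (\<exists>a\<in>P. wi j = C i a * w a j)" for j
      using Max_in[of "insert (if j = i then 1 else 0) ((\<lambda>a. C i a * w a j) ` P)"] finP
      unfolding wi_def[symmetric] by (auto simp: wi_def)
    have vi_in: "vi l = (if l \<in> K \<and> (l, i) \<in> parcs D then C i l else 0)
      \<or> (\<exists>a\<in>P. vi l = C i a * v a l)" for l
      using Max_in[of "insert (if l \<in> K \<and> (l, i) \<in> parcs D then C i l else 0)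
        ((\<lambda>a. C i a * v a l) ` P)"] finP
      unfolding vi_def[symmetric] by (auto simp: vi_def)
    have "unblocked D K j i" if pos: "wi j > 0" for j
    proof (cases "j = i")
      case True then show ?thesis using unblocked_refl[OF D less.prems] by simp
    next
      case False
      then obtain a where a: "a \<in> P" "wi j = C i a * w a j" using wi_in[of j] pos by auto
      then have "w a j > 0" using pos wge[of a j]
        by (metis (no_types, lifting) DiffD1 P_def mem_Collect_eq mult_zero_right order_less_le)
      then show ?thesis using a IH(2)[of a j] unblocked_step[OF dag, of K j a i]
        by (auto simp: P_def)
    qed
    moreover have "l \<in> K \<and> (l, i) \<in> (parcs D)\<^sup>+" if pos: "vi l > 0" for l
    proof (cases "l \<in> K \<and> (l, i) \<in> parcs D")
      case True then show ?thesis by auto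
    next
      case False
      then obtain a where a: "a \<in> P" "vi l = C i a * v a l" using vi_in[of l] pos by auto
      then have "v a l > 0" using pos vge[of a l]
        by (metis (no_types, lifting) DiffD1 P_def mem_Collect_eq mult_zero_right order_less_le)
      then show ?thesis using a IH(3)[of a l]
        by (auto simp: P_def intro: trancl_into_trancl)
    qed
    moreover have "max_expansion D C K i wi vi"
      unfolding max_expansion_def
    proof (intro conjI allI impI)
      show nn: "wi j \<ge> 0" for j using wi_ge(1)[of j] by (auto split: if_splits)
      show "vi l \<ge> 0" for l
        using vi_ge(1)[of l] Cge[of l] by (auto split: if_splits)
      show "wi i > 0" using wi_ge(1)[of i] by simp
      fix z x assume s: "solves D C z x"
      note ge = solves_ge[OF D s less.prems]
      have zpos: "z j > 0" if "j \<in> pverts D" for j using s that by (auto simp: solves_def)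
      have xpos: "x j > 0" if "j \<in> pverts D" for j using solves_ge(4)[OF D s that] .
      have IHs: "(\<forall>j\<in>pverts D. w a j * z j \<le> x a) \<and> (\<forall>l\<in>K. v a l * x l \<le> x a) \<and>
        ((\<exists>j\<in>pverts D. w a j > 0 \<and> x a = w a j * z j) \<or> (\<exists>l\<in>K. v a l > 0 \<and> x a = v a l * x l))"
        if "a \<in> P" for a
        using IH(1)[of a] s that by (auto simp: max_expansion_def P_def)
      have up: "C i a * y \<le> x i" if "a \<in> P" "y \<le> x a" for a y
        using ge(2)[of a] that Cge[of a] by (auto simp: P_def intro: mult_left_mono order_trans)
      show ubw: "\<forall>j\<in>pverts D. wi j * z j \<le> x i"
      proof
        fix j assume j: "j \<in> pverts D"
        show "wi j * z j \<le> x i"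
          using wi_in[of j]
        proof
          assume "wi j = (if j = i then 1 else 0)"
          then show ?thesis using ge(1,4) by auto
        next
          assume "\<exists>a\<in>P. wi j = C i a * w a j"
          then obtain a where a: "a \<in> P" "wi j = C i a * w a j" by auto
          then show ?thesis using up[OF a(1), of "w a j * z j"] IHs[OF a(1)] j
            by (simp add: mult.assoc)
        qed
      qed
      show ubv: "\<forall>l\<in>K. vi l * x l \<le> x i"
      proof
        fix l assume l: "l \<in> K"
        show "vi l * x l \<le> x i"
          using vi_in[of l]
        proof
          assume "vi l = (if l \<in> K \<and> (l, i) \<in> parcs D then C i l else 0)"
          then show ?thesis using ge(2)[of l] ge(4) by (auto split: if_splits)
        next
          assume "\<exists>a\<in>P. vi l = C i a * v a l"
          then obtain a where a: "a \<in> P" "vi l = C i a * v a l" by auto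
          then show ?thesis using up[OF a(1), of "v a l * x l"] IHs[OF a(1)] l
            by (simp add: mult.assoc)
        qed
      qed
      \<comment> \<open>The weight kept is at least \<open>c'\<close>; if the term of weight \<open>c'\<close> attains the maximum,
        then so does the term that was kept.\<close>
      have attained: "x i = c * y" "c > 0" if "c * y \<le> x i" "c' \<le> c" "x i = c' * y" "y > 0" for c c' y
      proof -
        show "x i = c * y" using that by (metis antisym_conv mult_le_cancel_right order_less_imp_not_less)
        then show "c > 0" using that(4) ge(4) by (simp add: zero_less_mult_iff)
      qed
      show "(\<exists>j\<in>pverts D. wi j > 0 \<and> x i = wi j * z j) \<or> (\<exists>l\<in>K. vi l > 0 \<and> x i = vi l * x l)"
        using ge(3)
      proof (elim disjE exE conjE)
        assume "x i = z i"
        then have "x i = wi i * z i" "wi i > 0"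
          using attained[of "wi i" "z i" 1] ubw less.prems wi_ge(1)[of i] zpos by auto
        then show ?thesis using less.prems by auto
      next
        fix a assume a: "(a, i) \<in> parcs D" "x i = C i a * x a"
        have aV: "a \<in> pverts D" using a(1) by (rule in_arcsD1)
        show ?thesis
        proof (cases "a \<in> K")
          case True
          then have "x i = vi a * x a" "vi a > 0"
            using attained[of "vi a" "x a" "C i a"] ubv a aV vi_ge(1)[of a] xpos by auto
          then show ?thesis using True by auto
        next
          case False
          then have aP: "a \<in> P" using a by (simp add: P_def)
          then consider j where "j \<in> pverts D" "x a = w a j * z j" | l where "l \<in> K" "v a l > 0" "x a = v a l * x l"
            using IHs[OF aP] by auto
          then show ?thesis
          proof cases
            case (1 j)
            have "x i = wi j * z j" "wi j > 0"
              by (rule attained[of "wi j" "z j" "C i a * w a j"];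
                  use 1 ubw a(2) wi_ge(2)[OF aP] zpos in \<open>simp add: mult.assoc\<close>)+
            then show ?thesis using 1 by auto
          next
            case (2 l)
            have "x l > 0" using 2 xpos[OF aV] by (simp add: zero_less_mult_iff)
            then have "x i = vi l * x l" "vi l > 0"
              by - (rule attained[of "vi l" "x l" "C i a * v a l"];
                  use 2 ubv a(2) vi_ge(2)[OF aP] in \<open>simp add: mult.assoc\<close>)+
            then show ?thesis using 2 by auto
          qed
        qed
      qed
    qed
    ultimately show ?case by blast
  qed
qed

section \<open>Patterns of the observed values\<close>

text \<open>The expansions of all nodes of \<open>V\<close> relative to the observed nodes \<open>K\<close>. The well-founded
  relation \<open>R\<close> orders the observed nodes so that observed values only depend on earlier ones.\<close>
locale max_system =
  fixes V K :: "'v set" and w v :: "'v \<Rightarrow> 'v \<Rightarrow> real" and R :: "('v \<times> 'v) set"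
  assumes finV: "finite V" and KV: "K \<subseteq> V" and wfR: "wf R"
    and v_R: "\<And>k l. k \<in> K \<Longrightarrow> l \<in> K \<Longrightarrow> v k l > 0 \<Longrightarrow> (l, k) \<in> R"
begin

lemma finK: "finite K" using finV KV by (rule finite_subset[rotated])

definition solution :: "('v \<Rightarrow> real) \<Rightarrow> ('v \<Rightarrow> real) \<Rightarrow> bool" where
  "solution z x \<longleftrightarrow> (\<forall>i\<in>V. z i > 0 \<and> x i > 0 \<and>
     (\<forall>j\<in>V. w i j * z j \<le> x i) \<and> (\<forall>l\<in>K. v i l * x l \<le> x i) \<and>
     ((\<exists>j\<in>V. w i j > 0 \<and> x i = w i j * z j) \<or> (\<exists>l\<in>K. v i l > 0 \<and> x i = v i l * x l)))"

text \<open>Ratios of observed values are compared by cross-multiplication, so products of two weights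
  occur as the coefficients of innovations in the coincidences that must be excluded.\<close>
definition coeff_products :: "real set" where
  "coeff_products = (\<lambda>(a, b, c, d). w a b * w c d) ` (V \<times> V \<times> V \<times> V)"

definition generic :: "('v \<Rightarrow> real) \<Rightarrow> bool" where
  "generic z \<longleftrightarrow> (\<forall>j\<in>V. \<forall>j'\<in>V. \<forall>q\<in>coeff_products. \<forall>q'\<in>coeff_products.
     j \<noteq> j' \<longrightarrow> q > 0 \<longrightarrow> q' > 0 \<longrightarrow> q * z j \<noteq> q' * z j')"

text \<open>Two features of the observed values \<open>x\<close> form their pattern. A tight edge explains \<open>x k\<close> by
  another observed value. A candidate \<open>(j, k)\<close> is an innovation whose bound
  \<open>Min (x k' / w k' j)\<close>, over all observed \<open>k'\<close> with \<open>w k' j > 0\<close>, is attained at \<open>k\<close>: only such a \<open>j\<close> can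
  explain \<open>x k\<close>.\<close>
definition tight_edges :: "('v \<Rightarrow> real) \<Rightarrow> ('v \<times> 'v) set" where
  "tight_edges x = {(l, k) \<in> K \<times> K. v k l > 0 \<and> x k = v k l * x l}"

definition candidates :: "('v \<Rightarrow> real) \<Rightarrow> ('v \<times> 'v) set" where
  "candidates x = {(j, k) \<in> V \<times> K. w k j > 0 \<and> (\<forall>k'\<in>K. x k * w k' j \<le> x k' * w k j)}"

lemma pattern_cong:
  assumes "\<And>k. k \<in> K \<Longrightarrow> x k = y k"
  shows "tight_edges x = tight_edges y" "candidates x = candidates y"
  using assms by (auto simp: tight_edges_def candidates_def)

lemma solution_le:
  assumes "solution z x" "i \<in> V"
  shows "j \<in> V \<Longrightarrow> w i j * z j \<le> x i" "l \<in> K \<Longrightarrow> v i l * x l \<le> x i"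
  using assms unfolding solution_def by blast+

lemma realiser_exists:
  assumes "solution z x" "k \<in> K" "k \<notin> snd ` tight_edges x"
  shows "\<exists>j\<in>V. w k j > 0 \<and> x k = w k j * z j"
proof -
  have "\<not> (\<exists>l\<in>K. v k l > 0 \<and> x k = v k l * x l)"
    using assms(2,3) by (force simp: tight_edges_def)
  then show ?thesis using assms(1,2) KV unfolding solution_def by blast
qed

lemma realiser_candidate:
  assumes s: "solution z x" and k: "k \<in> K" and j: "j \<in> V" "w k j > 0" "x k = w k j * z j"
  shows "(j, k) \<in> candidates x"
proof -
  have "x k * w k' j \<le> x k' * w k j" if "k' \<in> K" for k'
  proof -
    have "w k' j * z j \<le> x k'" using s that KV j(1) by (auto simp: solution_def)
    then have "w k j * (w k' j * z j) \<le> w k j * x k'" using j(2) by (intro mult_left_mono) auto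
    then show ?thesis by (simp add: j(3) mult_ac)
  qed
  then show ?thesis using k j by (auto simp: candidates_def)
qed

text \<open>A common candidate \<open>j\<close> fixes the ratio of \<open>x k\<close> and \<open>x k'\<close>. Generically such a coincidence
  only happens if one innovation explains both values. That innovation may differ from \<open>j\<close>.\<close>
lemma common_candidate_realiser:
  assumes "generic z" "(j, k) \<in> candidates x" "(j, k') \<in> candidates x"
    and i: "i \<in> V" "w k i > 0" "x k = w k i * z i"
    and i': "i' \<in> V" "w k' i' > 0" "x k' = w k' i' * z i'"
  shows "i = i'"
proof (rule ccontr)
  assume ne: "i \<noteq> i'"
  have c: "j \<in> V" "k \<in> V" "k' \<in> V" "w k j > 0" "w k' j > 0" "x k * w k' j = x k' * w k j"
    using assms(2,3) KV by (auto simp: candidates_def intro: antisym)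
  have "(w k i * w k' j) * z i = (w k' i' * w k j) * z i'"
    using c(6) by (simp add: i i' mult_ac)
  moreover have "w k i * w k' j \<in> coeff_products" "w k' i' * w k j \<in> coeff_products"
    unfolding coeff_products_def using c i i' by force+
  ultimately show False
    using \<open>generic z\<close> ne i i' c by (auto simp: generic_def)
qed

end

text \<open>A pattern is represented by an outcome that exhibits it. This makes facts about the pattern
  alone, such as the partition into blocks, provable by looking at that single outcome.\<close>
locale reference_solution = max_system +
  fixes z0 x0 :: "'a \<Rightarrow> real"
  assumes sol0: "solution z0 x0" and gen0: "generic z0"
begin

abbreviation "tight0 \<equiv> tight_edges x0"
abbreviation "cand0 \<equiv> candidates x0"

definition tops :: "'a set" where "tops = K - snd ` tight0"

definition realiser0 :: "'a \<Rightarrow> 'a" where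
  "realiser0 k = (SOME j. j \<in> V \<and> w k j > 0 \<and> x0 k = w k j * z0 j)"

text \<open>The observed values that share their explanation with \<open>k\<close>. One innovation must explain
  the whole block, so it has to be a candidate for all of it; these are the \<open>sources\<close>.\<close>
definition block :: "'a \<Rightarrow> 'a set" where
  "block k = {k' \<in> tops. realiser0 k' = realiser0 k}"

definition sources :: "'a \<Rightarrow> 'a set" where
  "sources k = {j \<in> V. \<forall>k'\<in>block k. (j, k') \<in> cand0}"

text \<open>Every observed value is a fixed multiple of the value at some top node, its root. Ratios
  along tight edges are coefficients, hence the multiple can be read off the reference outcome.
  The vector \<open>rebuilt z\<close> computes the observed values from the maxima over the disjoint source
  sets, which are independent for different blocks.\<close>
definition root :: "'a \<Rightarrow> 'a" where
  "root k = (SOME b. b \<in> tops \<and> (b, k) \<in> tight0\<^sup>*)"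

definition rebuilt :: "('a \<Rightarrow> real) \<Rightarrow> 'a \<Rightarrow> real" where
  "rebuilt z k = x0 k / x0 (root k) * Max ((\<lambda>j. w (root k) j * z j) ` sources (root k))"

lemma tops_K: "k \<in> tops \<Longrightarrow> k \<in> K" by (simp add: tops_def)

lemma realiser0:
  assumes "k \<in> tops"
  shows "realiser0 k \<in> V" "w k (realiser0 k) > 0" "x0 k = w k (realiser0 k) * z0 (realiser0 k)"
proof -
  have "\<exists>j. j \<in> V \<and> w k j > 0 \<and> x0 k = w k j * z0 j"
    using realiser_exists[OF sol0, of k] assms by (auto simp: tops_def)
  from someI_ex[OF this] show "realiser0 k \<in> V" "w k (realiser0 k) > 0"
    "x0 k = w k (realiser0 k) * z0 (realiser0 k)"
    by (auto simp: realiser0_def)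
qed

lemma realiser0_cand: "k \<in> tops \<Longrightarrow> (realiser0 k, k) \<in> cand0"
  using realiser_candidate[OF sol0 tops_K realiser0] .

lemma block_refl: "k \<in> tops \<Longrightarrow> k \<in> block k" by (simp add: block_def)

lemma finite_sources: "finite (sources k)" using finV by (simp add: sources_def)

lemma realiser0_sources: "k \<in> tops \<Longrightarrow> realiser0 k \<in> sources k"
  using realiser0(1)[of k] realiser0_cand by (fastforce simp: sources_def block_def)

lemma sources_V: "sources k \<subseteq> V" by (auto simp: sources_def)

lemma sources_le: "solution z x \<Longrightarrow> i \<in> V \<Longrightarrow> j \<in> sources k \<Longrightarrow> w i j * z j \<le> x i"
  unfolding solution_def sources_def by blast

lemma sources_pos: "j \<in> sources k \<Longrightarrow> k' \<in> block k \<Longrightarrow> w k' j > 0"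
  by (auto simp: sources_def candidates_def)

text \<open>A shared source is a common candidate of both nodes, hence at the reference outcome the
  same innovation explains both.\<close>
lemma sources_disjoint:
  assumes "k \<in> tops" "k' \<in> tops" "j \<in> sources k" "j \<in> sources k'"
  shows "block k = block k'"
proof -
  have "realiser0 k = realiser0 k'"
    using assms block_refl
      common_candidate_realiser[OF gen0 _ _ realiser0[OF assms(1)] realiser0[OF assms(2)]]
    by (auto simp: sources_def)
  then show ?thesis by (simp add: block_def)
qed

lemma root:
  assumes "k \<in> K"
  shows "root k \<in> tops" "(root k, k) \<in> tight0\<^sup>*"
proof -
  have "\<exists>b. b \<in> tops \<and> (b, k) \<in> tight0\<^sup>*"
    using assms
  proof (induction k rule: wf_induct_rule[OF wfR])
    case (1 k)
    show ?case
    proof (cases "k \<in> tops")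
      case True then show ?thesis by auto
    next
      case False
      then obtain l where l: "(l, k) \<in> tight0" using 1(2) by (auto simp: tops_def)
      then have "l \<in> K" "(l, k) \<in> R" using v_R by (auto simp: tight_edges_def)
      then show ?thesis using 1(1) l by (meson rtrancl.rtrancl_into_rtrancl)
    qed
  qed
  from someI_ex[OF this] show "root k \<in> tops" "(root k, k) \<in> tight0\<^sup>*"
    by (auto simp: root_def)
qed

lemma root_top:
  assumes "k \<in> tops"
  shows "root k = k"
  using root(2)[OF tops_K[OF assms]] assms by (auto simp: tops_def elim: rtranclE) (metis imageI rtranclE snd_conv)

lemma x0_pos: "k \<in> K \<Longrightarrow> x0 k > 0"
  using sol0 KV by (auto simp: solution_def)

lemma rebuilt_top:
  "k \<in> tops \<Longrightarrow> rebuilt z k = Max ((\<lambda>j. w k j * z j) ` sources k)"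
  using x0_pos[OF tops_K[of k]] by (simp add: rebuilt_def root_top)

text \<open>At a generic outcome with the reference pattern, the innovation explaining a top node also
  explains its whole block: the reference explanation is a common candidate of the block, so
  the explanations at the present outcome coincide. It is therefore a source.\<close>
lemma rebuilt_eq:
  assumes s: "solution z x" and g: "generic z"
    and L: "tight_edges x = tight0" and G: "candidates x = cand0" and k: "k \<in> K"
  shows "x k = rebuilt z k"
proof -
  have top: "x k = Max ((\<lambda>j. w k j * z j) ` sources k)" if k: "k \<in> tops" for k
  proof -
    have real: "\<exists>j\<in>V. w k j > 0 \<and> x k = w k j * z j" if "k \<in> tops" for k
      using realiser_exists[OF s tops_K[OF that]] L that by (auto simp: tops_def)
    obtain j where j: "j \<in> V" "w k j > 0" "x k = w k j * z j" using real[OF k] by auto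
    have "(j, k') \<in> cand0" if k': "k' \<in> block k" for k'
    proof -
      have k't: "k' \<in> tops" and r: "realiser0 k' = realiser0 k" using k' by (auto simp: block_def)
      obtain j' where j': "j' \<in> V" "w k' j' > 0" "x k' = w k' j' * z j'" using real[OF k't] by auto
      have "j = j'"
        using common_candidate_realiser[OF g _ _ j j'] realiser0_cand[OF k] realiser0_cand[OF k't]
        unfolding G r by auto
      then show ?thesis using realiser_candidate[OF s tops_K[OF k't] j'] by (simp add: G)
    qed
    then have "j \<in> sources k" using j(1) by (simp add: sources_def)
    moreover have "w k i * z i \<le> x k" if "i \<in> sources k" for i
      using sources_le[OF s _ that, of k] tops_K[OF k] KV by auto
    ultimately show ?thesis using finite_sources j(3)
      by (intro Max_eqI[symmetric]) auto
  qed
  have scale: "x k * x0 b = x0 k * x b" if "(b, k) \<in> tight0\<^sup>*" for b k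
    using that
  proof (induction rule: rtrancl_induct)
    case (step l k)
    then have "x k = v k l * x l" "x0 k = v k l * x0 l"
      using L by (auto simp: tight_edges_def)
    then show ?case using step.IH by simp
  qed simp
  show ?thesis
    using scale[OF root(2)[OF k]] top[OF root(1)[OF k]] x0_pos[OF tops_K[OF root(1)[OF k]]]
    by (simp add: rebuilt_def field_simps)
qed

text \<open>
  Conversely, the pattern can be verified on the rebuilt values. If these have the reference tight
  edges and respect all upper bounds, they satisfy the recursion of the observed values and
  equal them. Each bound on an innovation involves that innovation and the rebuilt values only,
  which is what makes the event of a pattern split over two independent groups of innovations.
\<close>
lemma rebuilt_eqI:
  assumes s: "solution z x"
    and L: "tight_edges (rebuilt z) = tight0"
    and wz: "\<And>k j. k \<in> K \<Longrightarrow> j \<in> V \<Longrightarrow> w k j * z j \<le> rebuilt z k"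
    and vr: "\<And>k l. k \<in> K \<Longrightarrow> l \<in> K \<Longrightarrow> v k l * rebuilt z l \<le> rebuilt z k"
    and k: "k \<in> K"
  shows "x k = rebuilt z k"
  using k
proof (induction k rule: wf_induct_rule[OF wfR])
  case (1 k)
  have kV: "k \<in> V" using 1(2) KV by auto
  have IH: "x l = rebuilt z l" if "l \<in> K" "v k l > 0" for l
    using 1 v_R that by auto
  show ?case
  proof (rule antisym)
    show "x k \<le> rebuilt z k"
      using s kV wz[OF 1(2)] vr[OF 1(2)] IH by (auto simp: solution_def)
    show "rebuilt z k \<le> x k"
    proof (cases "k \<in> tops")
      case True
      have "w k j * z j \<le> x k" if "j \<in> sources k" for j
        using sources_le[OF s kV that] .
      then show ?thesis
        unfolding rebuilt_top[OF True] using finite_sources realiser0_sources[OF True]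
        by (intro Max.boundedI) auto
    next
      case False
      then obtain l where "(l, k) \<in> tight_edges (rebuilt z)"
        using 1(2) L by (auto simp: tops_def)
      then have l: "l \<in> K" "v k l > 0" "rebuilt z k = v k l * rebuilt z l"
        by (auto simp: tight_edges_def)
      show ?thesis using solution_le(2)[OF s kV l(1)] IH[OF l(1,2)] l(3) by simp
    qed
  qed
qed

text \<open>The expansion of node \<open>i\<close> evaluated at given observed values \<open>y\<close>, with innovations restricted
  to a set \<open>A\<close> that contains all those of positive weight.\<close>
definition predicted :: "'a set \<Rightarrow> ('a \<Rightarrow> real) \<Rightarrow> ('a \<Rightarrow> real) \<Rightarrow> 'a \<Rightarrow> real" where
  "predicted A z y i = Max ((\<lambda>j. w i j * z j) ` A \<union> (\<lambda>l. v i l * y l) ` K)"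

lemma predicted_eq:
  assumes s: "solution z x" and xy: "\<And>l. l \<in> K \<Longrightarrow> x l = y l" and i: "i \<in> V"
    and A: "A \<subseteq> V" "\<And>j. j \<in> V \<Longrightarrow> w i j > 0 \<Longrightarrow> j \<in> A"
  shows "predicted A z y i = x i"
  unfolding predicted_def
proof (rule Max_eqI)
  have "finite A" using A(1) finV by (rule finite_subset)
  then show "finite ((\<lambda>j. w i j * z j) ` A \<union> (\<lambda>l. v i l * y l) ` K)"
    using finK by simp
  show "q \<le> x i" if "q \<in> (\<lambda>j. w i j * z j) ` A \<union> (\<lambda>l. v i l * y l) ` K" for q
    using that
  proof
    assume "q \<in> (\<lambda>j. w i j * z j) ` A"
    then show ?thesis using solution_le(1)[OF s i] A(1) by auto
  next
    assume "q \<in> (\<lambda>l. v i l * y l) ` K"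
    then obtain l where l: "l \<in> K" "q = v i l * y l" by auto
    show ?thesis using solution_le(2)[OF s i l(1)] xy[OF l(1)] l(2) by simp
  qed
  have "(\<exists>j\<in>V. w i j > 0 \<and> x i = w i j * z j) \<or> (\<exists>l\<in>K. x i = v i l * x l)"
    using s i unfolding solution_def by blast
  then show "x i \<in> (\<lambda>j. w i j * z j) ` A \<union> (\<lambda>l. v i l * y l) ` K"
    using A(2) xy by fastforce
qed

end

section \<open>Sigma-algebras of random vectors and null events\<close>

definition vector_algebra :: "'a measure \<Rightarrow> ('v \<Rightarrow> 'a \<Rightarrow> real) \<Rightarrow> 'v set \<Rightarrow> 'a measure" where
  "vector_algebra M X A =
    vimage_algebra (space M) (\<lambda>\<omega>. \<lambda>i\<in>A. X i \<omega>) (PiM A (\<lambda>_. borel))"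

lemma space_vector_algebra [simp]: "space (vector_algebra M X A) = space M"
  by (simp add: vector_algebra_def)

lemma measurable_vector_algebra:
  assumes "i \<in> A"
  shows "X i \<in> borel_measurable (vector_algebra M X A)"
proof -
  have "(\<lambda>\<omega>. \<lambda>i\<in>A. X i \<omega>) \<in> vector_algebra M X A \<rightarrow>\<^sub>M PiM A (\<lambda>_. borel)"
    unfolding vector_algebra_def by (rule measurable_vimage_algebra1) (auto simp: space_PiM)
  from measurable_compose[OF this measurable_component_singleton[OF assms]]
  show ?thesis using assms by simp
qed

lemma vector_algebra_least:
  assumes "space N = space M" "\<And>i. i \<in> A \<Longrightarrow> X i \<in> borel_measurable N"
  shows "sets (vector_algebra M X A) \<subseteq> sets N"
  unfolding vector_algebra_def
  by (rule sets_image_in_sets[OF assms(1)]) (use assms(2) in \<open>auto intro: measurable_restrict\<close>)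

lemma sets_vector_event:
  assumes "\<And>i. i \<in> I \<Longrightarrow> f i \<in> borel_measurable N" "S \<in> sets (PiM I (\<lambda>_. borel))"
  shows "{\<omega> \<in> space N. (\<lambda>i\<in>I. f i \<omega>) \<in> S} \<in> sets N"
proof -
  have "(\<lambda>\<omega>. \<lambda>i\<in>I. f i \<omega>) \<in> N \<rightarrow>\<^sub>M PiM I (\<lambda>_. borel)"
    using assms(1) by (intro measurable_restrict) auto
  from measurable_sets[OF this assms(2)] show ?thesis
    by (simp add: vimage_def Int_def conj_commute)
qed

lemma borel_measurable_mono_algebra:
  "f \<in> borel_measurable N \<Longrightarrow> space N = space N' \<Longrightarrow> sets N \<subseteq> sets N' \<Longrightarrow> f \<in> borel_measurable N'"
  by (rule measurable_from_subalg[of N' N]) (auto simp: subalgebra_def)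

context prob_space
begin

text \<open>By Fubini: once the first variable is fixed, the second one would have to hit a single
  point, which has probability zero because its law has no atoms.\<close>
lemma AE_scaled_neq:
  assumes ind: "indep_var borel Z1 borel Z2" and atom: "atom_free (distr M borel Z2)"
    and c: "c2 > (0::real)"
  shows "AE \<omega> in M. c1 * Z1 \<omega> \<noteq> c2 * Z2 \<omega>"
proof -
  have [measurable]: "Z1 \<in> borel_measurable M" "Z2 \<in> borel_measurable M"
    and eq: "distr M borel Z1 \<Otimes>\<^sub>M distr M borel Z2 =
      distr M (borel \<Otimes>\<^sub>M borel) (\<lambda>x. (Z1 x, Z2 x))"
    using ind unfolding indep_var_distribution_eq by auto
  interpret D1: prob_space "distr M borel Z1" by (rule prob_space_distr) simp
  interpret D2: prob_space "distr M borel Z2" by (rule prob_space_distr) simp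
  interpret P: pair_sigma_finite "distr M borel Z1" "distr M borel Z2" ..
  have "AE p in distr M borel Z1 \<Otimes>\<^sub>M distr M borel Z2. c1 * fst p \<noteq> c2 * snd p"
  proof (rule P.AE_pair_measure)
    show "{x \<in> space (distr M borel Z1 \<Otimes>\<^sub>M distr M borel Z2). c1 * fst x \<noteq> c2 * snd x}
      \<in> sets (distr M borel Z1 \<Otimes>\<^sub>M distr M borel Z2)"
      by measurable
    have "AE b in distr M borel Z2. c1 * a \<noteq> c2 * b" for a
    proof (rule AE_I')
      show "{c1 * a / c2} \<in> null_sets (distr M borel Z2)"
        using atom by (auto simp: atom_free_def null_sets_def)
    qed (use c in \<open>auto simp: field_simps\<close>)
    then show "AE a in distr M borel Z1. AE b in distr M borel Z2. c1 * fst (a, b) \<noteq> c2 * snd (a, b)"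
      by simp
  qed
  then show ?thesis unfolding eq by (auto dest!: AE_distrD[rotated])
qed

lemma indep_var_of_indep_vars:
  assumes "indep_vars (\<lambda>_. N) Z V" "i \<in> V" "j \<in> V" "i \<noteq> j"
  shows "indep_var N (Z i) N (Z j)"
proof -
  have "indep_var N ((\<lambda>f. f i) \<circ> (\<lambda>\<omega>. restrict (\<lambda>i. Z i \<omega>) {i}))
      N ((\<lambda>f. f j) \<circ> (\<lambda>\<omega>. restrict (\<lambda>i. Z i \<omega>) {j}))"
    by (rule indep_var_compose[OF indep_var_restrict[OF assms(1)]])
       (use assms in \<open>auto intro: measurable_component_singleton\<close>)
  then show ?thesis by (simp add: comp_def)
qed

lemma innovations_pos:
  assumes "innovations V Z" "i \<in> V"
  shows "AE \<omega> in M. Z i \<omega> > 0"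
proof -
  have "Z i \<in> borel_measurable M"
    using assms by (auto simp: innovations_def indep_vars_def)
  moreover have "AE x in distr M borel (Z i). x \<in> {0<..}"
    using assms by (auto simp: innovations_def has_support_def)
  ultimately show ?thesis using AE_distrD[of "Z i" M borel "\<lambda>x. x \<in> {0<..}"] by simp
qed

lemma AE_generic:
  assumes sys: "max_system V K v R" and inn: "innovations V Z"
  shows "AE \<omega> in M. max_system.generic V w (\<lambda>i. Z i \<omega>)"
proof -
  interpret max_system V K w v R by (rule sys)
  have fin: "finite coeff_products" using finV by (simp add: coeff_products_def)
  have ne: "AE \<omega> in M. q * Z j \<omega> \<noteq> q' * Z j' \<omega>"
    if "j \<in> V" "j' \<in> V" "j \<noteq> j'" "q' > 0" for j j' q q'
  proof (rule AE_scaled_neq)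
    show "indep_var borel (Z j) borel (Z j')"
      by (rule indep_var_of_indep_vars[where V = V]) (use inn that in \<open>auto simp: innovations_def\<close>)
  qed (use inn that in \<open>auto simp: innovations_def\<close>)
  show ?thesis
    unfolding generic_def
    using finV fin ne by (intro AE_finite_allI AE_impI) auto
qed

end

lemma (in max_system) sets_pattern:
  assumes [measurable]: "\<And>k. k \<in> K \<Longrightarrow> Y k \<in> borel_measurable N"
  shows "{\<omega> \<in> space N. tight_edges (\<lambda>k. Y k \<omega>) = tight_edges x0 \<and>
    candidates (\<lambda>k. Y k \<omega>) = candidates x0} \<in> sets N"
proof -
  have sub: "tight_edges x \<subseteq> K \<times> K" "candidates x \<subseteq> V \<times> K" for x
    by (auto simp: tight_edges_def candidates_def)
  have "(tight_edges x = tight_edges x0) \<longleftrightarrow>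
      (\<forall>l\<in>K. \<forall>k\<in>K. ((l, k) \<in> tight_edges x) = ((l, k) \<in> tight_edges x0))" for x
    using sub(1)[of x] sub(1)[of x0] by blast
  then have T: "(tight_edges x = tight_edges x0) \<longleftrightarrow> (\<forall>l\<in>K. \<forall>k\<in>K.
      (v k l > 0 \<and> x k = v k l * x l) = ((l, k) \<in> tight_edges x0))" for x
    by (simp add: tight_edges_def)
  have "(candidates x = candidates x0) \<longleftrightarrow>
      (\<forall>j\<in>V. \<forall>k\<in>K. ((j, k) \<in> candidates x) = ((j, k) \<in> candidates x0))" for x
    using sub(2)[of x] sub(2)[of x0] by blast
  then have C: "(candidates x = candidates x0) \<longleftrightarrow> (\<forall>j\<in>V. \<forall>k\<in>K.
      (w k j > 0 \<and> (\<forall>k'\<in>K. x k * w k' j \<le> x k' * w k j)) = ((j, k) \<in> candidates x0))" for x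
    by (simp add: candidates_def)
  note [simp] = finK finV
  show ?thesis
    unfolding T C by measurable
qed

lemma (in reference_solution) measurable_rebuilt:
  assumes "\<And>j. j \<in> sources (root k) \<Longrightarrow> Z j \<in> borel_measurable N"
  shows "(\<lambda>\<omega>. rebuilt (\<lambda>j. Z j \<omega>) k) \<in> borel_measurable N"
  unfolding rebuilt_def using assms finite_sources
  by (intro borel_measurable_times borel_measurable_const borel_measurable_Max) auto

lemma (in reference_solution) measurable_predicted:
  assumes "finite A" "\<And>j. j \<in> A \<Longrightarrow> Z j \<in> borel_measurable N" "\<And>l. l \<in> K \<Longrightarrow> Y l \<in> borel_measurable N"
  shows "(\<lambda>\<omega>. predicted A (\<lambda>j. Z j \<omega>) (\<lambda>l. Y l \<omega>) i) \<in> borel_measurable N"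
proof -
  have union: "f ` A \<union> g ` K = (\<lambda>t. case t of Inl j \<Rightarrow> f j | Inr l \<Rightarrow> g l) ` (A <+> K)"
    for f g :: "'a \<Rightarrow> real"
    by (auto simp: Plus_def image_Un image_image)
  show ?thesis
    unfolding predicted_def union using assms finK
    by (intro borel_measurable_Max) (auto simp: Plus_def)
qed

section \<open>Conditional independence on a single pattern\<close>

text \<open>
  The innovations are divided into two groups. The first one, \<open>P1\<close>, consists of the innovations
  \<open>AI\<close> that reach \<open>I\<close> and of the sources of all blocks in which every node is reached from \<open>AI\<close>.
  No node of such a block is reached from the innovations \<open>AJ\<close> of \<open>J\<close>, so its sources avoid
  \<open>AJ\<close>. Every other block has a node not reached from \<open>AI\<close>; a source reaches all nodes of its
  block, so the sources of such a block avoid \<open>AI\<close>. Thus \<open>AJ\<close> and the remaining sources lie in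
  the second group. On the event of the pattern the observed values equal the rebuilt ones,
  each of which is a function of one group, and \<open>cond_prob_product_local\<close> applies.
\<close>
lemma (in prob_space) cond_prob_product_on_pattern:
  fixes Z X :: "'v \<Rightarrow> 'a \<Rightarrow> real"
  assumes ref: "reference_solution V K w v R z0 x0"
    and Zind: "indep_vars (\<lambda>_. borel) Z V"
    and Xm: "\<And>i. i \<in> V \<Longrightarrow> X i \<in> borel_measurable M"
    and sol: "AE \<omega> in M. max_system.solution V K w v (\<lambda>i. Z i \<omega>) (\<lambda>i. X i \<omega>) \<and>
      max_system.generic V w (\<lambda>i. Z i \<omega>)"
    and IJ: "I \<subseteq> V" "J \<subseteq> V"
    and disj: "\<And>i i' j. i \<in> I \<Longrightarrow> i' \<in> J \<Longrightarrow> j \<in> V \<Longrightarrow> \<not> (w i j > 0 \<and> w i' j > 0)"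
    and sep: "\<And>i i' j j' k. i \<in> I \<Longrightarrow> i' \<in> J \<Longrightarrow> j \<in> V \<Longrightarrow> j' \<in> V \<Longrightarrow> k \<in> K \<Longrightarrow>
      w i j > 0 \<Longrightarrow> w i' j' > 0 \<Longrightarrow> \<not> (w k j > 0 \<and> w k j' > 0)"
    and S: "S \<in> sets (PiM I (\<lambda>_. borel))" and T: "T \<in> sets (PiM J (\<lambda>_. borel))"
  defines "A \<equiv> {\<omega> \<in> space M. (\<lambda>i\<in>I. X i \<omega>) \<in> S}" and "B \<equiv> {\<omega> \<in> space M. (\<lambda>i\<in>J. X i \<omega>) \<in> T}"
    and "F \<equiv> vector_algebra M X K"
  shows "AE \<omega> in M. max_system.tight_edges K v (\<lambda>i. X i \<omega>) = max_system.tight_edges K v x0 \<and>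
      max_system.candidates V K w (\<lambda>i. X i \<omega>) = max_system.candidates V K w x0 \<longrightarrow>
    nn_cond_exp M F (indicator (A \<inter> B)) \<omega> =
    nn_cond_exp M F (indicator A) \<omega> * nn_cond_exp M F (indicator B) \<omega>"
proof -
  interpret reference_solution V K w v R z0 x0 by (rule ref)
  define AI where "AI = {j \<in> V. \<exists>i\<in>I. w i j > 0}"
  define AJ where "AJ = {j \<in> V. \<exists>i\<in>J. w i j > 0}"
  \<comment> \<open>Observed nodes reached from \<open>AI\<close>; by \<open>sep\<close> none of them is reached from \<open>AJ\<close>.\<close>
  define KI where "KI = {k \<in> K. \<exists>j\<in>AI. w k j > 0}"
  define K1 where "K1 = {k \<in> K. block (root k) \<subseteq> KI}"
  define P1 where "P1 = AI \<union> (\<Union>k\<in>K1. sources (root k))"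
  define P2 where "P2 = V - P1"
  have P: "P1 \<inter> P2 = {}" "P1 \<subseteq> V" "P2 \<subseteq> V" "P1 \<union> P2 = V" "finite P1" "finite P2"
    using sources_V finV by (auto simp: P1_def P2_def AI_def intro: finite_subset[OF _ finV])
  have AJ_P2: "AJ \<subseteq> P2"
  proof
    fix j assume j: "j \<in> AJ"
    have "j \<notin> AI" using j disj by (auto simp: AI_def AJ_def)
    moreover have "j \<notin> sources (root k)" if "k \<in> K1" for k
    proof
      assume jr: "j \<in> sources (root k)"
      have "root k \<in> block (root k)" using that root by (auto simp: K1_def intro: block_refl)
      then have "root k \<in> KI" "w (root k) j > 0"
        using that sources_pos[OF jr] by (auto simp: K1_def)
      then show False using j sep by (auto simp: KI_def AI_def AJ_def)
    qed
    ultimately show "j \<in> P2" using j by (auto simp: P2_def P1_def AJ_def)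
  qed
  have src1: "sources (root k) \<subseteq> P1" if "k \<in> K1" for k using that by (auto simp: P1_def)
  have src2: "sources (root k) \<subseteq> P2" if k: "k \<in> K - K1" for k
  proof
    fix j assume j: "j \<in> sources (root k)"
    have jV: "j \<in> V" using j sources_V by auto
    obtain k' where k': "k' \<in> block (root k)" "k' \<notin> KI" using k by (auto simp: K1_def)
    have "w k' j > 0" by (rule sources_pos[OF j k'(1)])
    moreover have "k' \<in> K" using k'(1) tops_K by (auto simp: block_def)
    ultimately have "j \<notin> AI" using k'(2) by (auto simp: KI_def)
    moreover have "j \<notin> sources (root k2)" if k2: "k2 \<in> K1" for k2
    proof
      assume "j \<in> sources (root k2)"
      then have "block (root k) = block (root k2)"
        using sources_disjoint[OF root(1) root(1) j] k k2 by (auto simp: K1_def)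
      then show False using k k2 by (auto simp: K1_def)
    qed
    ultimately show "j \<in> P2" using jV by (auto simp: P2_def P1_def)
  qed
  define Y where "Y = (\<lambda>k \<omega>. rebuilt (\<lambda>j. Z j \<omega>) k)"
  have Zm: "Z j \<in> borel_measurable M" if "j \<in> V" for j
    using Zind that by (auto simp: indep_vars_def)
  have Ym: "Y k \<in> borel_measurable M" for k
    unfolding Y_def using sources_V Zm by (intro measurable_rebuilt) auto
  define G1 G2 F1 F2 where "G1 = vector_algebra M Z P1" and "G2 = vector_algebra M Z P2"
    and "F1 = vector_algebra M Y K1" and "F2 = vector_algebra M Y (K - K1)"
  have sp [simp]: "space G1 = space M" "space G2 = space M" "space F1 = space M" "space F2 = space M"
    by (simp_all add: G1_def G2_def F1_def F2_def)
  have spJ [simp]: "space (joint_algebra G1 F2) = space M" "space (joint_algebra G2 F1) = space M"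
    "space (joint_algebra F1 F2) = space M"
    by (simp_all add: space_joint_algebra)
  have G: "subalgebra M G1" "subalgebra M G2"
    unfolding subalgebra_def G1_def G2_def
    using P Zm by (intro conjI vector_algebra_least; auto)+
  have ZG: "j \<in> P1 \<Longrightarrow> Z j \<in> borel_measurable G1" "j \<in> P2 \<Longrightarrow> Z j \<in> borel_measurable G2" for j
    unfolding G1_def G2_def by (auto intro: measurable_vector_algebra)
  have YG: "k \<in> K1 \<Longrightarrow> Y k \<in> borel_measurable G1" "k \<in> K - K1 \<Longrightarrow> Y k \<in> borel_measurable G2" for k
    unfolding Y_def using src1[of k] src2[of k] ZG by (auto intro!: measurable_rebuilt)
  have Fs: "subalgebra G1 F1" "subalgebra G2 F2"
    unfolding F1_def F2_def subalgebra_def using YG by (intro conjI vector_algebra_least; simp)+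
  have YF: "k \<in> K1 \<Longrightarrow> Y k \<in> borel_measurable F1" "k \<in> K - K1 \<Longrightarrow> Y k \<in> borel_measurable F2" for k
    unfolding F1_def F2_def by (auto intro: measurable_vector_algebra)
  note up1 = joint_algebra_upper[of F2 G1, simplified] and up2 = joint_algebra_upper[of F1 G2, simplified]
  have ZJ: "j \<in> P1 \<Longrightarrow> Z j \<in> borel_measurable (joint_algebra G1 F2)"
    "j \<in> P2 \<Longrightarrow> Z j \<in> borel_measurable (joint_algebra G2 F1)" for j
    using borel_measurable_mono_algebra[OF ZG(1) _ up1(1)] borel_measurable_mono_algebra[OF ZG(2) _ up2(1)]
    by auto
  have YJ: "Y k \<in> borel_measurable (joint_algebra G1 F2)" "Y k \<in> borel_measurable (joint_algebra G2 F1)"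
    "Y k \<in> borel_measurable (joint_algebra F1 F2)" if "k \<in> K" for k
    using that borel_measurable_mono_algebra[OF YG(1) _ up1(1)] borel_measurable_mono_algebra[OF YF(2) _ up1(2)]
      borel_measurable_mono_algebra[OF YG(2) _ up2(1)] borel_measurable_mono_algebra[OF YF(1) _ up2(2)]
      borel_measurable_mono_algebra[OF YF(1) _ joint_algebra_upper(1)[of F2 F1]]
      borel_measurable_mono_algebra[OF YF(2) _ joint_algebra_upper(2)[of F2 F1]]
    by (cases "k \<in> K1"; simp)+
  have ind: "indep_set (sets G1) (sets G2)"
    using indep_var_restrict[OF Zind P(1-3)]
    by (simp add: indep_var_eq G1_def G2_def vector_algebra_def sets_vimage_algebra)
  let ?X = "\<lambda>\<omega>. \<lambda>k\<in>K. X k \<omega>" and ?Y = "\<lambda>\<omega>. \<lambda>k\<in>K. Y k \<omega>"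
  define E where "E = {\<omega> \<in> space M. tight_edges (\<lambda>i. X i \<omega>) = tight0 \<and> candidates (\<lambda>i. X i \<omega>) = cand0}"
  \<comment> \<open>The event \<open>E\<close> expressed by the rebuilt values: bounds on each group of innovations, and
    conditions on the rebuilt values alone, which are put with the second group.\<close>
  define E1 where "E1 = {\<omega> \<in> space M. \<forall>j\<in>P1. \<forall>k\<in>K. w k j * Z j \<omega> \<le> Y k \<omega>}"
  define E2 where "E2 = {\<omega> \<in> space M. \<forall>j\<in>P2. \<forall>k\<in>K. w k j * Z j \<omega> \<le> Y k \<omega>} \<inter>
    {\<omega> \<in> space M. tight_edges (\<lambda>k. Y k \<omega>) = tight0 \<and> candidates (\<lambda>k. Y k \<omega>) = cand0} \<inter>
    {\<omega> \<in> space M. \<forall>k\<in>K. \<forall>l\<in>K. v k l * Y l \<omega> \<le> Y k \<omega>}"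
  have XY: "X k \<omega> = Y k \<omega>"
    if "solution (\<lambda>i. Z i \<omega>) (\<lambda>i. X i \<omega>) \<and> generic (\<lambda>i. Z i \<omega>)" "\<omega> \<in> E" "k \<in> K" for \<omega> k
    unfolding Y_def using that by (intro rebuilt_eq) (auto simp: E_def)
  have EF: "E \<in> sets (vector_algebra M X K)"
    unfolding E_def using sets_pattern[of X "vector_algebra M X K"]
    by (simp add: measurable_vector_algebra)
  have XYae: "AE \<omega> in M. \<omega> \<in> E \<longrightarrow> ?X \<omega> = ?Y \<omega>"
    using sol by eventually_elim (auto simp: fun_eq_iff XY)
  have E1s: "E1 \<in> sets (joint_algebra G1 F2)"
    unfolding E1_def spJ(1)[symmetric] using P(5) finK ZJ YJ
    by (intro sets.sets_Collect_finite_All borel_measurable_le) auto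
  have E2s: "E2 \<in> sets (joint_algebra G2 F1)"
    unfolding E2_def spJ(2)[symmetric] using P(6) finK ZJ YJ
    by (intro sets.Int sets.sets_Collect_finite_All borel_measurable_le sets_pattern) auto
  have E12: "AE \<omega> in M. \<omega> \<in> E \<longleftrightarrow> \<omega> \<in> E1 \<inter> E2"
    using sol AE_space
  proof eventually_elim
    case (elim \<omega>)
    let ?z = "\<lambda>i. Z i \<omega>" and ?x = "\<lambda>i. X i \<omega>" and ?y = "\<lambda>i. Y i \<omega>"
    show ?case
    proof
      assume E: "\<omega> \<in> E"
      have pat: "tight_edges ?x = tight_edges ?y" "candidates ?x = candidates ?y"
        using XY[OF elim(1) E] by (auto intro!: pattern_cong)
      have sol: "solution ?z ?x" using elim(1) by simp
      have "w k j * Z j \<omega> \<le> Y k \<omega>" if "k \<in> K" "j \<in> V" for k j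
        using solution_le(1)[OF sol subsetD[OF KV that(1)] that(2)] XY[OF elim(1) E that(1)] by simp
      moreover have "v k l * Y l \<omega> \<le> Y k \<omega>" if "k \<in> K" "l \<in> K" for k l
        using solution_le(2)[OF sol subsetD[OF KV that(1)] that(2)]
          XY[OF elim(1) E that(1)] XY[OF elim(1) E that(2)] by simp
      ultimately show "\<omega> \<in> E1 \<inter> E2"
        using E P pat by (auto simp: E_def E1_def E2_def)
    next
      assume e12: "\<omega> \<in> E1 \<inter> E2"
      have "X k \<omega> = Y k \<omega>" if "k \<in> K" for k
        unfolding Y_def
      proof (rule rebuilt_eqI[OF conjunct1[OF elim(1)]])
        show "tight_edges (rebuilt ?z) = tight0"
          using e12 by (auto simp: E2_def Y_def)
        show "w k j * Z j \<omega> \<le> rebuilt ?z k" if "k \<in> K" "j \<in> V" for k j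
          using e12 that P(4) by (auto simp: E1_def E2_def Y_def)
        show "v k l * rebuilt ?z l \<le> rebuilt ?z k" if "k \<in> K" "l \<in> K" for k l
          using e12 that by (auto simp: E2_def Y_def)
      qed (rule that)
      then have "tight_edges ?x = tight_edges ?y" "candidates ?x = candidates ?y"
        by (auto intro!: pattern_cong)
      then show "\<omega> \<in> E" using e12 by (auto simp: E_def E2_def)
    qed
  qed
  have ev: "A \<in> events" "B \<in> events"
    unfolding A_def B_def using Xm IJ S T
    by (auto intro!: sets_vector_event)
  \<comment> \<open>On \<open>E\<close> the unobserved values are functions of their own group and the rebuilt values.\<close>
  define A' where "A' = {\<omega> \<in> space M. (\<lambda>i\<in>I. predicted AI (\<lambda>j. Z j \<omega>) (\<lambda>l. Y l \<omega>) i) \<in> S}"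
  define B' where "B' = {\<omega> \<in> space M. (\<lambda>i\<in>J. predicted AJ (\<lambda>j. Z j \<omega>) (\<lambda>l. Y l \<omega>) i) \<in> T}"
  have A's: "A' \<in> sets (joint_algebra G1 F2)"
    unfolding A'_def spJ(1)[symmetric]
    using P(5) ZJ(1) YJ(1) S
    by (intro sets_vector_event measurable_predicted) (auto simp: P1_def)
  have B's: "B' \<in> sets (joint_algebra G2 F1)"
    unfolding B'_def spJ(2)[symmetric]
    using finite_subset[OF AJ_P2 P(6)] ZJ(2) YJ(2) T AJ_P2
    by (intro sets_vector_event measurable_predicted) auto
  have pred: "AE \<omega> in M. \<omega> \<in> E \<longrightarrow>
      (\<forall>i\<in>I. predicted AI (\<lambda>j. Z j \<omega>) (\<lambda>l. Y l \<omega>) i = X i \<omega>) \<and>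
      (\<forall>i\<in>J. predicted AJ (\<lambda>j. Z j \<omega>) (\<lambda>l. Y l \<omega>) i = X i \<omega>)"
    using sol
  proof eventually_elim
    case (elim \<omega>)
    show ?case
      using elim XY[OF elim] IJ
      by (auto intro!: predicted_eq[of "\<lambda>j. Z j \<omega>" "\<lambda>i. X i \<omega>"] simp: AI_def AJ_def)
  qed
  have AA': "AE \<omega> in M. \<omega> \<in> E \<longrightarrow> (\<omega> \<in> A \<longleftrightarrow> \<omega> \<in> A')"
    using pred by eventually_elim (auto simp: A_def A'_def E_def cong: restrict_cong)
  have BB': "AE \<omega> in M. \<omega> \<in> E \<longrightarrow> (\<omega> \<in> B \<longleftrightarrow> \<omega> \<in> B')"
    using pred by eventually_elim (auto simp: B_def B'_def E_def cong: restrict_cong)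
  have F12: "sets F1 \<subseteq> sets (vector_algebra M Y K)" "sets F2 \<subseteq> sets (vector_algebra M Y K)"
    unfolding F1_def F2_def
    by (intro vector_algebra_least; auto simp: K1_def intro: measurable_vector_algebra)+
  have Yj: "?Y \<in> joint_algebra F1 F2 \<rightarrow>\<^sub>M PiM K (\<lambda>_. borel)"
    using YJ(3) by (intro measurable_restrict) auto
  have XYm: "?X \<in> M \<rightarrow>\<^sub>M PiM K (\<lambda>_. borel)" "?Y \<in> M \<rightarrow>\<^sub>M PiM K (\<lambda>_. borel)"
    using Xm Ym KV by (auto intro!: measurable_restrict)
  have "AE \<omega> in M. \<omega> \<in> E \<longrightarrow> nn_cond_exp M F (indicator (A \<inter> B)) \<omega> =
      nn_cond_exp M F (indicator A) \<omega> * nn_cond_exp M F (indicator B) \<omega>"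
    using cond_prob_product_local[OF XYm G ind Fs F12[unfolded vector_algebra_def[of M Y K]] Yj
        EF[unfolded vector_algebra_def] XYae E1s E2s E12 ev(1) A's AA' ev(2) B's BB']
    unfolding F_def vector_algebra_def .
  then show ?thesis
    using AE_space by eventually_elim (auto simp: E_def)
qed

section \<open>Measurability and reduction to conditional probabilities\<close>

context prob_space
begin

lemma max_linear_bn_measurable:
  assumes dag: "is_dag D" and inn: "innovations (pverts D) Z" and X: "max_linear_bn D C Z X"
    and i: "i \<in> pverts D"
  shows "X i \<in> borel_measurable M"
proof -
  interpret pair_digraph D using dag by (simp add: is_dag_def)
  have "wf (parcs D)" using pair_finite_arcs dag by (auto simp: is_dag_def intro: finite_acyclic_wf)
  then show ?thesis using i
  proof (induction i rule: wf_induct_rule)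
    case (less i)
    define P where "P = {j. (j, i) \<in> parcs D}"
    have "P \<subseteq> fst ` parcs D" by (force simp: P_def)
    then have fin: "finite P" using pair_finite_arcs finite_surj by blast
    define f where "f = (\<lambda>t \<omega>. case t of None \<Rightarrow> Z i \<omega> | Some j \<Rightarrow> C i j * X j \<omega>)"
    have Zi: "Z i \<in> borel_measurable M"
      using inn less.prems by (auto simp: innovations_def indep_vars_def)
    have XP: "X j \<in> borel_measurable M" if "j \<in> P" for j
      using less.IH[of j] in_arcsD1[of j i] that by (simp add: P_def)
    have "(\<lambda>\<omega>. Max ((\<lambda>t. f t \<omega>) ` insert None (Some ` P))) \<in> borel_measurable M"
      using fin Zi XP by (intro borel_measurable_Max) (auto simp: f_def)
    moreover have "X i \<omega> = Max ((\<lambda>t. f t \<omega>) ` insert None (Some ` P))" if "\<omega> \<in> space M" for \<omega>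
    proof -
      have "insert (Z i \<omega>) {C i j * X j \<omega> | j. (j, i) \<in> parcs D} =
          (\<lambda>t. f t \<omega>) ` insert None (Some ` P)"
        by (auto simp: f_def P_def image_image)
      then show ?thesis using X that less.prems by (simp add: max_linear_bn_def)
    qed
    ultimately show ?case by (simp cong: measurable_cong)
  qed
qed

text \<open>Passes from conditional probabilities with values in \<open>ennreal\<close>, in which the preceding
  arguments avoid all integrability conditions, to real conditional expectations.\<close>
lemma cond_indep_subvectorsI:
  assumes Xm: "\<And>i. i \<in> I \<union> J \<union> K \<Longrightarrow> X i \<in> borel_measurable M"
    and prod: "\<And>S T. S \<in> sets (PiM I (\<lambda>_. borel)) \<Longrightarrow> T \<in> sets (PiM J (\<lambda>_. borel)) \<Longrightarrow>
      AE \<omega> in M.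
        nn_cond_exp M (vector_algebra M X K)
          (indicator ({\<omega> \<in> space M. (\<lambda>i\<in>I. X i \<omega>) \<in> S} \<inter> {\<omega> \<in> space M. (\<lambda>j\<in>J. X j \<omega>) \<in> T})) \<omega> =
        nn_cond_exp M (vector_algebra M X K) (indicator {\<omega> \<in> space M. (\<lambda>i\<in>I. X i \<omega>) \<in> S}) \<omega> *
        nn_cond_exp M (vector_algebra M X K) (indicator {\<omega> \<in> space M. (\<lambda>j\<in>J. X j \<omega>) \<in> T}) \<omega>"
  shows "cond_indep_subvectors X I J K"
  unfolding cond_indep_subvectors_def cond_indep_var_def
proof (intro conjI ballI)
  show "random_variable (PiM I (\<lambda>_. borel)) (\<lambda>\<omega>. \<lambda>i\<in>I. X i \<omega>)"
    "random_variable (PiM J (\<lambda>_. borel)) (\<lambda>\<omega>. \<lambda>i\<in>J. X i \<omega>)"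
    and K: "random_variable (PiM K (\<lambda>_. borel)) (\<lambda>\<omega>. \<lambda>i\<in>K. X i \<omega>)"
    using Xm by (auto intro!: measurable_restrict)
  fix S T :: "('b \<Rightarrow> real) set"
  assume S: "S \<in> sets (PiM I (\<lambda>_. borel))" and T: "T \<in> sets (PiM J (\<lambda>_. borel))"
  let ?F = "vimage_algebra (space M) (\<lambda>\<omega>. \<lambda>k\<in>K. X k \<omega>) (PiM K (\<lambda>_. borel))"
  let ?A = "{\<omega> \<in> space M. (\<lambda>i\<in>I. X i \<omega>) \<in> S}" and ?B = "{\<omega> \<in> space M. (\<lambda>j\<in>J. X j \<omega>) \<in> T}"
  have F: "subalgebra M ?F" using K by (rule subalgebra_vimage)
  have ev: "?A \<in> events" "?B \<in> events"
    using Xm S T by (auto intro!: sets_vector_event)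
  have AB: "{\<omega> \<in> space M. (\<lambda>i\<in>I. X i \<omega>) \<in> S \<and> (\<lambda>j\<in>J. X j \<omega>) \<in> T} = ?A \<inter> ?B" by auto
  show "AE \<omega> in M. real_cond_exp M ?F
      (indicator {\<omega> \<in> space M. (\<lambda>i\<in>I. X i \<omega>) \<in> S \<and> (\<lambda>j\<in>J. X j \<omega>) \<in> T}) \<omega> =
      real_cond_exp M ?F (indicator ?A) \<omega> * real_cond_exp M ?F (indicator ?B) \<omega>"
    unfolding AB
    using prod[OF S T, unfolded vector_algebra_def] real_cond_exp_indicator[OF F ev(1)]
      real_cond_exp_indicator[OF F ev(2)] real_cond_exp_indicator[OF F sets.Int[OF ev]]
    by eventually_elim (simp add: enn2real_mult)
qed

end

section \<open>Paths connecting innovations of both sides\<close>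

text \<open>Paths of the forms (a) and (b): an innovation at \<open>h\<close> enters the values at both ends.\<close>
lemma star_path_common_ancestor:
  assumes "h = i \<or> (h, i) \<in> parcs G" "h = j \<or> (h, j) \<in> parcs G" "i \<noteq> j" "{i, j, h} \<inter> K = {}"
  shows "\<exists>p. star_connecting_path G K i p j"
proof -
  consider "h = i" | "h = j" | "h \<noteq> i" "h \<noteq> j" by auto
  then show ?thesis
  proof cases
    case 1
    then have "star_form G K [i, j]" using assms by (intro star_form.a) auto
    then show ?thesis by (intro exI[of _ "[i, j]"]) (auto simp: star_connecting_path_def)
  next
    case 2
    then have "star_form G K (rev [i, j])" using assms by (auto intro!: star_form.a)
    then show ?thesis by (intro exI[of _ "[i, j]"]) (auto simp: star_connecting_path_def)
  next
    case 3
    then have "star_form G K [i, h, j]" using assms by (intro star_form.b) auto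
    then show ?thesis by (intro exI[of _ "[i, h, j]"]) (auto simp: star_connecting_path_def)
  qed
qed

text \<open>Paths of the forms (c), (d) and (e), in which the innovations at \<open>h\<close> and \<open>h'\<close> enter the two
  ends and both enter the observed value at \<open>k\<close>.\<close>
lemma star_path_collider:
  assumes "h = i \<or> (h, i) \<in> parcs G" "h' = j \<or> (h', j) \<in> parcs G"
    and "(h, k) \<in> parcs G" "(h', k) \<in> parcs G" "k \<in> K"
    and "i \<noteq> j" "h \<noteq> h'" "h \<noteq> j" "h' \<noteq> i" "{i, j, h, h'} \<inter> K = {}"
  shows "\<exists>p. star_connecting_path G K i p j"
proof -
  consider "h = i" "h' = j" | "h \<noteq> i" "h' = j" | "h = i" "h' \<noteq> j" | "h \<noteq> i" "h' \<noteq> j" by auto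
  then show ?thesis
  proof cases
    case 1
    then have "star_form G K [i, k, j]" using assms by (intro star_form.c) auto
    then show ?thesis by (intro exI[of _ "[i, k, j]"]) (auto simp: star_connecting_path_def)
  next
    case 2
    then have "star_form G K [i, h, k, j]" using assms by (intro star_form.d) auto
    then show ?thesis by (intro exI[of _ "[i, h, k, j]"]) (auto simp: star_connecting_path_def)
  next
    case 3
    then have "star_form G K [j, h', k, i]" using assms by (intro star_form.d) auto
    then show ?thesis by (intro exI[of _ "[i, k, h', j]"]) (auto simp: star_connecting_path_def)
  next
    case 4
    then have "star_form G K [i, h, k, h', j]" using assms by (intro star_form.e) auto
    then show ?thesis by (intro exI[of _ "[i, h, k, h', j]"]) (auto simp: star_connecting_path_def)
  qed
qed

section \<open>Conditional independence from separation\<close>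

theorem theorem5p15:
  fixes D :: "nat pair_pre_digraph" and d :: nat
    and I J K :: "nat set"
    and C :: "nat \<Rightarrow> nat \<Rightarrow> real"
    and M :: "'a measure" and Z X :: "nat \<Rightarrow> 'a \<Rightarrow> real"
  assumes "is_dag D" and "pverts D = {1..d}"
    and "I \<subseteq> pverts D" and "J \<subseteq> pverts D" and "K \<subseteq> pverts D"
    and "I \<inter> J = {}" and "I \<inter> K = {}" and "J \<inter> K = {}"
    and "\<not> (\<exists>i\<in>I. \<exists>j\<in>J. \<exists>p. star_connecting_path (cond_reach_dag D K) K i p j)"
    and "coeff_matrix D C"
    and "prob_space M"
    and "prob_space.innovations M {1..d} Z"
    and "prob_space.max_linear_bn M D C Z X"
  shows "prob_space.cond_indep_subvectors M X I J K"
proof -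
  interpret prob_space M by (rule assms(11))
  define V where "V = pverts D"
  have inn: "innovations V Z" using assms(2,12) by (simp add: V_def)
  have fin: "finite V" and IJK: "I \<subseteq> V" "J \<subseteq> V" "K \<subseteq> V"
    using assms(2-5) by (auto simp: V_def)
  note bn = assms(13) and dag = assms(1)
  have D: "pair_digraph D" using dag by (simp add: is_dag_def)
  have Xm: "X i \<in> borel_measurable M" if "i \<in> V" for i
    using max_linear_bn_measurable[OF dag _ bn] inn that by (simp add: V_def)
  let ?ok = "\<lambda>i wv. max_expansion D C K i (fst wv) (snd wv) \<and>
    (\<forall>j. fst wv j > 0 \<longrightarrow> unblocked D K j i) \<and>
    (\<forall>l. snd wv l > 0 \<longrightarrow> l \<in> K \<and> (l, i) \<in> (parcs D)\<^sup>+)"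
  have "\<forall>i\<in>V. \<exists>wv. ?ok i wv"
    using max_expansion_exists[OF dag assms(10)] by (fastforce simp: V_def)
  then obtain wv where wv: "\<forall>i\<in>V. ?ok i (wv i)" by (rule bchoice[THEN exE])
  define w v where "w = (\<lambda>i. fst (wv i))" and "v = (\<lambda>i. snd (wv i))"
  have exp: "max_expansion D C K i (w i) (v i)"
    and w_unblocked: "w i j > 0 \<Longrightarrow> unblocked D K j i"
    and v_trancl: "v i l > 0 \<Longrightarrow> (l, i) \<in> (parcs D)\<^sup>+" if "i \<in> V" for i j l
    using wv that by (auto simp: w_def v_def)
  have w_self: "w i i > 0" if "i \<in> V" for i using exp[OF that] by (simp add: max_expansion_def)
  have sys: "max_system V K v ((parcs D)\<^sup>+)"
  proof
    have "wf (parcs D)"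
      using D dag by (auto simp: is_dag_def pair_digraph_def pair_fin_digraph_def
          pair_fin_digraph_axioms_def intro: finite_acyclic_wf)
    then show "wf ((parcs D)\<^sup>+)" by (rule wf_trancl)
  qed (use fin IJK v_trancl in auto)
  interpret max_system V K w v "(parcs D)\<^sup>+" by (rule sys)
  have sol: "AE \<omega> in M. solution (\<lambda>i. Z i \<omega>) (\<lambda>i. X i \<omega>) \<and> generic (\<lambda>i. Z i \<omega>)"
  proof -
    have pos: "AE \<omega> in M. \<forall>i\<in>V. Z i \<omega> > 0"
      using fin innovations_pos[OF inn] by (intro AE_finite_allI) auto
    show ?thesis using pos AE_generic[OF sys inn, of w] AE_space
    proof eventually_elim
      case (elim \<omega>)
      have s: "solves D C (\<lambda>i. Z i \<omega>) (\<lambda>i. X i \<omega>)"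
        using elim bn by (auto simp: solves_def max_linear_bn_def V_def)
      have "solution (\<lambda>i. Z i \<omega>) (\<lambda>i. X i \<omega>)"
        unfolding solution_def
      proof
        fix i assume i: "i \<in> V"
        have "X i \<omega> > 0" using solves_ge(4)[OF D s] i by (simp add: V_def)
        then show "Z i \<omega> > 0 \<and> X i \<omega> > 0 \<and>
          (\<forall>j\<in>V. w i j * Z j \<omega> \<le> X i \<omega>) \<and> (\<forall>l\<in>K. v i l * X l \<omega> \<le> X i \<omega>) \<and>
          ((\<exists>j\<in>V. w i j > 0 \<and> X i \<omega> = w i j * Z j \<omega>) \<or> (\<exists>l\<in>K. v i l > 0 \<and> X i \<omega> = v i l * X l \<omega>))"
          using elim(1) i exp[OF i] s unfolding max_expansion_def V_def by blast
      qed
      then show ?case using elim by simp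
    qed
  qed
  let ?G = "cond_reach_dag D K"
  have reach: "j = i \<or> (j, i) \<in> parcs ?G" "j \<noteq> i \<Longrightarrow> j \<notin> K" if "i \<in> V" "w i j > 0" for i j
    using unblocked_cond_reach[OF w_unblocked[OF that]] by auto
  \<comment> \<open>The two separation properties: an innovation shared by \<open>I\<close> and \<open>J\<close>, or two innovations of
    \<open>I\<close> and \<open>J\<close> meeting at an observed node, would give a \<open>*\<close>-connecting path.\<close>
  have disj: "\<not> (w i j > 0 \<and> w i' j > 0)" if "i \<in> I" "i' \<in> J" for i i' j
  proof
    assume "w i j > 0 \<and> w i' j > 0"
    then have "\<exists>p. star_connecting_path ?G K i p i'"
      using reach[of i j] reach[of i' j] that IJK assms(6-8)
      by (intro star_path_common_ancestor[of j]) auto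
    then show False using assms(9) that by auto
  qed
  have sep: "\<not> (w k h > 0 \<and> w k h' > 0)"
    if "i \<in> I" "i' \<in> J" "k \<in> K" "w i h > 0" "w i' h' > 0" for i i' h h' k
  proof
    assume k: "w k h > 0 \<and> w k h' > 0"
    have V: "i \<in> V" "i' \<in> V" "k \<in> V" "i \<notin> K" "i' \<notin> K" using that IJK assms(6-8) by auto
    have hK: "h \<notin> K" "h' \<notin> K"
      using reach(2)[OF V(1) that(4)] reach(2)[OF V(2) that(5)] V(4,5) by auto
    have "h \<noteq> h'" "h \<noteq> i'" "h' \<noteq> i" "i \<noteq> i'"
      using disj[OF that(1,2)] that w_self[OF V(1)] w_self[OF V(2)] by auto
    moreover have "(h, k) \<in> parcs ?G" "(h', k) \<in> parcs ?G"
      using reach(1)[OF V(3)] k that(3) hK by auto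
    ultimately have "\<exists>p. star_connecting_path ?G K i p i'"
      using reach(1)[OF V(1) that(4)] reach(1)[OF V(2) that(5)] that(3) hK V
      by (intro star_path_collider[of h _ _ h' _ k]) auto
    then show False using assms(9) that by auto
  qed
  show ?thesis
  proof (rule cond_indep_subvectorsI)
    show "X i \<in> borel_measurable M" if "i \<in> I \<union> J \<union> K" for i using Xm that IJK by auto
    fix S T :: "(nat \<Rightarrow> real) set"
    assume S: "S \<in> sets (PiM I (\<lambda>_. borel))" and T: "T \<in> sets (PiM J (\<lambda>_. borel))"
    let ?p = "\<lambda>A. nn_cond_exp M (vector_algebra M X K) (indicator A)"
    let ?A = "{\<omega> \<in> space M. (\<lambda>i\<in>I. X i \<omega>) \<in> S}" and ?B = "{\<omega> \<in> space M. (\<lambda>j\<in>J. X j \<omega>) \<in> T}"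
    let ?x = "\<lambda>\<omega> i. X i \<omega>" and ?z = "\<lambda>\<omega> i. Z i \<omega>"
    let ?patterns = "Pow (K \<times> K) \<times> Pow (V \<times> K)"
    have "AE \<omega> in M. (tight_edges (?x \<omega>), candidates (?x \<omega>)) = q \<longrightarrow>
        ?p (?A \<inter> ?B) \<omega> = ?p ?A \<omega> * ?p ?B \<omega>" for q
      \<comment> \<open>A pattern shown by no outcome outside the exceptional null set has probability zero;
        any other pattern has a reference outcome.\<close>
    proof (cases "\<exists>\<omega>0\<in>space M. solution (?z \<omega>0) (?x \<omega>0) \<and> generic (?z \<omega>0) \<and>
        (tight_edges (?x \<omega>0), candidates (?x \<omega>0)) = q")
      case True
      then obtain \<omega>0 where w0: "solution (?z \<omega>0) (?x \<omega>0)" "generic (?z \<omega>0)"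
        "q = (tight_edges (?x \<omega>0), candidates (?x \<omega>0))" by auto
      have ref: "reference_solution V K w v ((parcs D)\<^sup>+) (?z \<omega>0) (?x \<omega>0)"
        by (intro reference_solution.intro reference_solution_axioms.intro sys w0)
      have Zind: "indep_vars (\<lambda>_. borel) Z V" using inn by (simp add: innovations_def)
      show ?thesis
        using cond_prob_product_on_pattern[OF ref Zind Xm sol IJK(1,2) disj sep S T]
        unfolding w0(3) by simp
    next
      case False
      show ?thesis using sol AE_space by eventually_elim (use False in auto)
    qed
    then have "AE \<omega> in M. \<forall>q\<in>?patterns. (tight_edges (?x \<omega>), candidates (?x \<omega>)) = q \<longrightarrow>
        ?p (?A \<inter> ?B) \<omega> = ?p ?A \<omega> * ?p ?B \<omega>"
      using fin finK by (intro AE_finite_allI) auto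
    moreover have "(tight_edges (?x \<omega>), candidates (?x \<omega>)) \<in> ?patterns" for \<omega>
      by (auto simp: tight_edges_def candidates_def)
    ultimately show "AE \<omega> in M. ?p (?A \<inter> ?B) \<omega> = ?p ?A \<omega> * ?p ?B \<omega>"
      by (auto elim!: eventually_mono)
  qed
qed

end
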